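(* Let $sc$ be the Split Cycle VCCR (over linear profiles). Then: (i) $sc$ satisfies Anonymity, Neutrality, Availability, Homogeneity, Monotonicity, Neutral Reversal, Coherent IIA, Coherent Defeat, and Positive Involvement in Defeat; (ii) if $f$ is any VCCR satisfying Anonymity, Neutrality, Availability, Upward Homogeneity, Monotonicity for two-candidate profiles, Neutral Reversal, Coherent IIA, Coherent Defeat, and Positive Involvement in Defeat, then $f=sc$, i.e. $f(\mathbf P)=sc(\mathbf P)$ for every profile $\mathbf P$. (Since Homogeneity implies Upward Homogeneity and Monotonicity implies Monotonicity for two-candidate profiles, $sc$ is the unique VCCR satisfying these axioms under either reading.)
   Context: Fix infinite sets $\mathcal V$ (voters) and $\mathcal X$ (candidates). For a finite set $X$, $\mathcal L(X)$ is the set of strict linear orders on $X$. A (linear) profile is a function $\mathbf P:V\to\mathcal L(X)$ for some nonempty finite $V\subset\mathcal V$ and nonempty finite $X\subset\mathcal X$; write $V(\mathbf P)=V$, $X(\mathbf P)=X$. Voter $i$ ranks $x$ above $y$ if $(x,y)\in\mathbf P(i)$. For nonempty $Y\subseteq X(\mathbf P)$, $\mathbf P_{|Y}$ is the profile with the same voters in which each ballot is restricted to $Y$. $\mathrm{Margin}_{\mathbf P}(x,y)$ is the number of voters ranking $x$ above $y$ minus the number ranking $y$ above $x$; $x$ is majority preferred to $y$ if this is $>0$. The margin graph $\mathcal M(\mathbf P)$ has vertex set $X(\mathbf P)$ and an edge $x\to y$ of weight $\mathrm{Margin}_{\mathbf P}(x,y)$ whenever this margin is positive. A majority path from $x_1$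 to $x_n$ is a sequence $(x_1,\dots,x_n)$ with $\mathrm{Margin}_{\mathbf P}(x_i,x_{i+1})>0$ for all $i<n$; its strength is $\min_i \mathrm{Margin}_{\mathbf P}(x_i,x_{i+1})$; it is a majority cycle if $x_n=x_1$. A VCCR is a function $f$ assigning to every profile $\mathbf P$ an asymmetric binary relation $f(\mathbf P)$ on $X(\mathbf P)$; "$x$ defeats $y$ in $\mathbf P$" means $(x,y)\in f(\mathbf P)$. The Split Cycle VCCR $sc$: $(x,y)\in sc(\mathbf P)$ iff $\mathrm{Margin}_{\mathbf P}(x,y)>0$ and $\mathrm{Margin}_{\mathbf P}(x,y)$ is strictly greater than the strength of every majority path from $y$ to $x$. Axioms for a VCCR $f$: Anonymity: if $V(\mathbf P)=V(\mathbf P')$ and there is a bijection $\pi$ of $V(\mathbf P)$ with $\mathbf P'(i)=\mathbf P(\pi(i))$ for all $i$, then $f(\mathbf P)=f(\mathbf P')$. Neutrality: if $V(\mathbf P)=V(\mathbf P')$, $X(\mathbf P)=X(\mathbf P')$ and there is a bijection $\pi$ of $X(\mathbf P)$ such that for all $i$ and $x,y$, $(x,y)\in\mathbf P(i)$ iff $(\pi(x),\pi(y))\in\mathbf P'(i)$, then $(x,y)\in f(\mathbf P)$ iff $(\pi(x),\pi(y))\in f(\mathbf P')$. Availability: for every $\mathbf P$ some $x\in X(\mathbf P)$ is defeated by no candidate. Homogeneity (resp. Upward Homogeneity): $f(\mathbf P)=f(2\mathbf P)$ (resp. $f(\mathbf P)\subseteq f(2\mathbf P)$), where $2\mathbf P$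 replaces each voter by two copies. Monotonicity (resp. for two-candidate profiles): for every profile (resp. every profile with two candidates) $\mathbf P$, if $\mathbf P'$ is obtained by moving $x$ up one place in one voter's ballot (swapping $x$ with the candidate immediately above it, all other relative orders unchanged), then $(x,y)\in f(\mathbf P)$ implies $(x,y)\in f(\mathbf P')$. Neutral Reversal: if $\mathbf P'$ is obtained from $\mathbf P$ by adding two voters whose ballots are converses of each other, then $f(\mathbf P)=f(\mathbf P')$. Coherent IIA: write $\mathbf P\rightsquigarrow_{x,y}\mathbf P'$ if $\mathbf P_{|\{x,y\}}=\mathbf P'_{|\{x,y\}}$ and $\mathcal M(\mathbf P')$ can be obtained from $\mathcal M(\mathbf P)$ by deleting zero or more candidates other than $x,y$ and deleting or reducing the weights of zero or more edges not connecting $x$ and $y$. Coherent IIA: if $(x,y)\in f(\mathbf P)$ and $\mathbf P\rightsquigarrow_{x,y}\mathbf P'$ then $(x,y)\in f(\mathbf P')$. Coherent Defeat: if $\mathrm{Margin}_{\mathbf P}(x,y)>0$ and there is no majority path from $y$ to $x$ in $\mathbf P$, then $(x,y)\in f(\mathbf P)$. Positive Involvement in Defeat: if $(x,y)\notin f(\mathbf P)$ and $\mathbf P'$ is obtained from $\mathbf P$ by adding one new voter who ranks $y$ above $x$, then $(x,y)\notin f(\mathbf P')$. *)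

theory Defs
  imports Main
begin

text \<open>Profiles. A profile consists of a finite nonempty set of voters, a finite nonempty
set of candidates, and a ballot for every voter. For canonicity, ballots of non-voters
are required to be empty, so that profiles correspond one-to-one to the functions
V \<rightarrow> L(X) of the paper.\<close>

record ('v, 'c) profile =
  voters :: "'v set"
  cands  :: "'c set"
  ballot :: "'v \<Rightarrow> ('c \<times> 'c) set"

text \<open>Strict linear orders on X: (x,y) in r means x is ranked above y.\<close>
definition lin_order :: "'c set \<Rightarrow> ('c \<times> 'c) set \<Rightarrow> bool" where
  "lin_order X r \<longleftrightarrow> r \<subseteq> X \<times> X \<and> strict_linear_order_on X r"

definition is_profile :: "('v, 'c) profile \<Rightarrow> bool" where
  "is_profile P \<longleftrightarrow> finite (voters P) \<and> voters P \<noteq> {} \<and> finite (cands P) \<and> cands P \<noteq> {}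
     \<and> (\<forall>i\<in>voters P. lin_order (cands P) (ballot P i))
     \<and> (\<forall>i. i \<notin> voters P \<longrightarrow> ballot P i = {})"

definition margin :: "('v, 'c) profile \<Rightarrow> 'c \<Rightarrow> 'c \<Rightarrow> int" where
  "margin P x y = int (card {i\<in>voters P. (x, y) \<in> ballot P i})
                 - int (card {i\<in>voters P. (y, x) \<in> ballot P i})"

definition majority_path :: "('v, 'c) profile \<Rightarrow> 'c list \<Rightarrow> bool" where
  "majority_path P xs \<longleftrightarrow> length xs \<ge> 2 \<and>
     (\<forall>k. k + 1 < length xs \<longrightarrow> margin P (xs ! k) (xs ! (k + 1)) > 0)"

definition strength :: "('v, 'c) profile \<Rightarrow> 'c list \<Rightarrow> int" where
  "strength P xs = Min {margin P (xs ! k) (xs ! (k + 1)) | k. k + 1 < length xs}"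

definition sc :: "('v, 'c) profile \<Rightarrow> ('c \<times> 'c) set" where
  "sc P = {(x, y). margin P x y > 0 \<and>
     (\<forall>xs. majority_path P xs \<and> hd xs = y \<and> last xs = x \<longrightarrow> margin P x y > strength P xs)}"

definition vccr :: "(('v, 'c) profile \<Rightarrow> ('c \<times> 'c) set) \<Rightarrow> bool" where
  "vccr f \<longleftrightarrow> (\<forall>P. is_profile P \<longrightarrow> f P \<subseteq> cands P \<times> cands P \<and>
                 (\<forall>x y. (x, y) \<in> f P \<longrightarrow> (y, x) \<notin> f P))"

definition anonymity :: "(('v, 'c) profile \<Rightarrow> ('c \<times> 'c) set) \<Rightarrow> bool" where
  "anonymity f \<longleftrightarrow> (\<forall>P Q \<pi>. is_profile P \<and> is_profile Q \<and> voters Q = voters P \<and> cands Q = cands P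
     \<and> bij_betw \<pi> (voters P) (voters P) \<and> (\<forall>i\<in>voters P. ballot Q i = ballot P (\<pi> i))
     \<longrightarrow> f P = f Q)"

definition neutrality :: "(('v, 'c) profile \<Rightarrow> ('c \<times> 'c) set) \<Rightarrow> bool" where
  "neutrality f \<longleftrightarrow> (\<forall>P Q \<pi>. is_profile P \<and> is_profile Q \<and> voters Q = voters P \<and> cands Q = cands P
     \<and> bij_betw \<pi> (cands P) (cands P)
     \<and> (\<forall>i\<in>voters P. \<forall>x\<in>cands P. \<forall>y\<in>cands P. (x, y) \<in> ballot P i \<longleftrightarrow> (\<pi> x, \<pi> y) \<in> ballot Q i)
     \<longrightarrow> (\<forall>x\<in>cands P. \<forall>y\<in>cands P. (x, y) \<in> f P \<longleftrightarrow> (\<pi> x, \<pi> y) \<in> f Q))"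

definition availability :: "(('v, 'c) profile \<Rightarrow> ('c \<times> 'c) set) \<Rightarrow> bool" where
  "availability f \<longleftrightarrow> (\<forall>P. is_profile P \<longrightarrow> (\<exists>x\<in>cands P. \<forall>y. (y, x) \<notin> f P))"

definition doubling :: "('v, 'c) profile \<Rightarrow> ('v, 'c) profile \<Rightarrow> bool" where
  "doubling P Q \<longleftrightarrow> is_profile P \<and> is_profile Q \<and> cands Q = cands P \<and>
     (\<exists>g. (\<forall>j\<in>voters Q. g j \<in> voters P \<and> ballot Q j = ballot P (g j))
        \<and> (\<forall>i\<in>voters P. card {j\<in>voters Q. g j = i} = 2))"

definition homogeneity :: "(('v, 'c) profile \<Rightarrow> ('c \<times> 'c) set) \<Rightarrow> bool" where
  "homogeneity f \<longleftrightarrow> (\<forall>P Q. doubling P Q \<longrightarrow> f P = f Q)"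

definition upward_homogeneity :: "(('v, 'c) profile \<Rightarrow> ('c \<times> 'c) set) \<Rightarrow> bool" where
  "upward_homogeneity f \<longleftrightarrow> (\<forall>P Q. doubling P Q \<longrightarrow> f P \<subseteq> f Q)"

definition one_up :: "('v, 'c) profile \<Rightarrow> ('v, 'c) profile \<Rightarrow> 'c \<Rightarrow> bool" where
  "one_up P Q x \<longleftrightarrow> is_profile P \<and> is_profile Q \<and> voters Q = voters P \<and> cands Q = cands P \<and>
     (\<exists>i\<in>voters P. \<exists>z. (z, x) \<in> ballot P i \<and> \<not> (\<exists>w. (z, w) \<in> ballot P i \<and> (w, x) \<in> ballot P i)
        \<and> ballot Q = (ballot P)(i := (ballot P i - {(z, x)}) \<union> {(x, z)}))"

definition monotonicity :: "(('v, 'c) profile \<Rightarrow> ('c \<times> 'c) set) \<Rightarrow> bool" where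
  "monotonicity f \<longleftrightarrow> (\<forall>P Q x y. one_up P Q x \<and> (x, y) \<in> f P \<longrightarrow> (x, y) \<in> f Q)"

definition monotonicity_two :: "(('v, 'c) profile \<Rightarrow> ('c \<times> 'c) set) \<Rightarrow> bool" where
  "monotonicity_two f \<longleftrightarrow> (\<forall>P Q x y. card (cands P) = 2 \<and> one_up P Q x \<and> (x, y) \<in> f P
     \<longrightarrow> (x, y) \<in> f Q)"

definition add_reversal :: "('v, 'c) profile \<Rightarrow> ('v, 'c) profile \<Rightarrow> bool" where
  "add_reversal P Q \<longleftrightarrow> is_profile P \<and> is_profile Q \<and> cands Q = cands P \<and>
     (\<exists>i j r. i \<notin> voters P \<and> j \<notin> voters P \<and> i \<noteq> j \<and> lin_order (cands P) r
        \<and> voters Q = voters P \<union> {i, j} \<and> ballot Q = (ballot P)(i := r, j := r\<inverse>))"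

definition neutral_reversal :: "(('v, 'c) profile \<Rightarrow> ('c \<times> 'c) set) \<Rightarrow> bool" where
  "neutral_reversal f \<longleftrightarrow> (\<forall>P Q. add_reversal P Q \<longrightarrow> f P = f Q)"

definition restrict :: "('v, 'c) profile \<Rightarrow> 'c set \<Rightarrow> ('v, 'c) profile" where
  "restrict P Y = \<lparr>voters = voters P, cands = Y, ballot = (\<lambda>i. ballot P i \<inter> (Y \<times> Y))\<rparr>"

text \<open>The relation P \<leadsto>_{x,y} Q of Coherent IIA: same restriction to {x,y}, and the margin
graph of Q arises from that of P by deleting candidates other than x,y and deleting or
reducing the weights of edges not connecting x and y.\<close>
definition ciia_step :: "('v, 'c) profile \<Rightarrow> 'c \<Rightarrow> 'c \<Rightarrow> ('v, 'c) profile \<Rightarrow> bool" where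
  "ciia_step P x y Q \<longleftrightarrow> is_profile P \<and> is_profile Q \<and> x \<in> cands Q \<and> y \<in> cands Q
     \<and> restrict P {x, y} = restrict Q {x, y}
     \<and> cands Q \<subseteq> cands P
     \<and> margin Q x y = margin P x y
     \<and> (\<forall>a\<in>cands Q. \<forall>b\<in>cands Q. {a, b} \<noteq> {x, y} \<longrightarrow> margin Q a b > 0
          \<longrightarrow> margin P a b > 0 \<and> margin Q a b \<le> margin P a b)"

definition coherent_IIA :: "(('v, 'c) profile \<Rightarrow> ('c \<times> 'c) set) \<Rightarrow> bool" where
  "coherent_IIA f \<longleftrightarrow> (\<forall>P Q x y. (x, y) \<in> f P \<and> ciia_step P x y Q \<longrightarrow> (x, y) \<in> f Q)"

definition coherent_defeat :: "(('v, 'c) profile \<Rightarrow> ('c \<times> 'c) set) \<Rightarrow> bool" where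
  "coherent_defeat f \<longleftrightarrow> (\<forall>P x y. is_profile P \<and> margin P x y > 0
     \<and> \<not> (\<exists>xs. majority_path P xs \<and> hd xs = y \<and> last xs = x) \<longrightarrow> (x, y) \<in> f P)"

definition add_voter :: "('v, 'c) profile \<Rightarrow> 'v \<Rightarrow> ('c \<times> 'c) set \<Rightarrow> ('v, 'c) profile \<Rightarrow> bool" where
  "add_voter P i r Q \<longleftrightarrow> is_profile P \<and> is_profile Q \<and> i \<notin> voters P \<and> lin_order (cands P) r
     \<and> voters Q = insert i (voters P) \<and> cands Q = cands P \<and> ballot Q = (ballot P)(i := r)"

definition positive_involvement_defeat :: "(('v, 'c) profile \<Rightarrow> ('c \<times> 'c) set) \<Rightarrow> bool" where
  "positive_involvement_defeat f \<longleftrightarrow> (\<forall>P Q i r x y. (x, y) \<notin> f P \<and> add_voter P i r Q \<and> (y, x) \<in> r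
     \<longrightarrow> (x, y) \<notin> f Q)"

end

theory Submission
  imports Defs
begin

text \<open>A pair \<open>(x, y)\<close> is a Split Cycle defeat iff the margin \<open>m\<close> of \<open>x\<close> over \<open>y\<close> is positive and
\<open>x\<close> is not reachable from \<open>y\<close> along edges of weight at least \<open>m\<close>. In this form each axiom for
Split Cycle only concerns margins, which are sums over the voters, and reachability.

Conversely, let \<open>f\<close> satisfy the axioms. Reversal pairs, permutations of voters and Coherent IIA show
that a defeat of \<open>y\<close> by \<open>x\<close> under \<open>f\<close> survives every change of profile that keeps the margin of
\<open>x\<close> over \<open>y\<close> and does not increase the other positive margins. If \<open>x\<close> defeats \<open>y\<close> although a path
of strength at least \<open>m\<close> leads from \<open>y\<close> to \<open>x\<close>, one may thus pass, after doubling, to a profile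
whose margin graph is a cycle with constant weights; its rotational symmetry makes everybody on the
cycle defeated, against Availability. If \<open>x\<close> defeats \<open>y\<close> under Split Cycle, voters ranking \<open>y\<close>
above \<open>x\<close> can be added until no majority path from \<open>y\<close> to \<open>x\<close> is left; Coherent Defeat applies
there, and Positive Involvement in Defeat carries the defeat back.\<close>

section \<open>Linear orders and margins\<close>

text \<open>The contribution 1, -1 or 0 of a single ballot to a margin. It turns margins into sums
  over the voters, so that adding, permuting or copying voters acts linearly.\<close>

definition net :: "('c \<times> 'c) set \<Rightarrow> 'c \<Rightarrow> 'c \<Rightarrow> int" where
  "net r a b = of_bool ((a, b) \<in> r) - of_bool ((b, a) \<in> r)"

lemma net_converse: "net (r\<inverse>) a b = - net r a b"
  by (simp add: net_def)

lemma abs_net_le: "\<bar>net r a b\<bar> \<le> 1"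
  by (simp add: net_def)

lemma margin_eq_sum:
  assumes "finite (voters P)"
  shows "margin P a b = (\<Sum>i\<in>voters P. net (ballot P i) a b)"
  using assms by (simp add: margin_def net_def sum_subtractf Collect_conj_eq)

lemma margin_swap: "margin P b a = - margin P a b"
  by (simp add: margin_def)

lemma margin_self [simp]: "margin P a a = 0"
  by (simp add: margin_def)

lemma lin_order_subset: "lin_order X r \<Longrightarrow> r \<subseteq> X \<times> X"
  by (simp add: lin_order_def)

lemma lin_order_asym:
  assumes "lin_order X r" "(a, b) \<in> r"
  shows "(b, a) \<notin> r"
  using assms unfolding lin_order_def strict_linear_order_on_def
  by (meson irreflD transD)

lemma lin_order_irrefl: "lin_order X r \<Longrightarrow> (a, a) \<notin> r"
  using lin_order_asym by fastforce

lemma lin_order_trans: "lin_order X r \<Longrightarrow> (a, b) \<in> r \<Longrightarrow> (b, c) \<in> r \<Longrightarrow> (a, c) \<in> r"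
  unfolding lin_order_def strict_linear_order_on_def by (meson transD)

lemma lin_order_total:
  "lin_order X r \<Longrightarrow> a \<in> X \<Longrightarrow> b \<in> X \<Longrightarrow> a \<noteq> b \<Longrightarrow> (a, b) \<in> r \<or> (b, a) \<in> r"
  unfolding lin_order_def strict_linear_order_on_def total_on_def by blast

lemma lin_orderI:
  assumes "r \<subseteq> X \<times> X"
    and "\<And>a. (a, a) \<notin> r"
    and "\<And>a b c. (a, b) \<in> r \<Longrightarrow> (b, c) \<in> r \<Longrightarrow> (a, c) \<in> r"
    and "\<And>a b. a \<in> X \<Longrightarrow> b \<in> X \<Longrightarrow> a \<noteq> b \<Longrightarrow> (a, b) \<in> r \<or> (b, a) \<in> r"
  shows "lin_order X r"
  unfolding lin_order_def strict_linear_order_on_def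
  using assms by (auto simp: irrefl_def total_on_def intro!: transI)

lemma lin_order_empty: "lin_order {} {}"
  by (rule lin_orderI) auto

lemma lin_order_singleton: "lin_order {a} {}"
  by (rule lin_orderI) auto

lemma lin_order_converse: "lin_order X r \<Longrightarrow> lin_order X (r\<inverse>)"
  by (rule lin_orderI)
    (auto dest: lin_order_subset lin_order_irrefl lin_order_trans lin_order_total)

text \<open>Stacking one order on top of another; ballots with a prescribed block structure are put
  together this way below.\<close>

lemma lin_order_append:
  assumes r: "lin_order X r" and s: "lin_order Y s" and "X \<inter> Y = {}"
  shows "lin_order (X \<union> Y) (r \<union> s \<union> X \<times> Y)"
proof (rule lin_orderI)
  note sub = lin_order_subset[OF r] lin_order_subset[OF s]
  show "r \<union> s \<union> X \<times> Y \<subseteq> (X \<union> Y) \<times> (X \<union> Y)"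
    using sub by blast
  show "(a, a) \<notin> r \<union> s \<union> X \<times> Y" for a
    using lin_order_irrefl[OF r] lin_order_irrefl[OF s] assms(3) by blast
  show "(a, c) \<in> r \<union> s \<union> X \<times> Y"
    if "(a, b) \<in> r \<union> s \<union> X \<times> Y" "(b, c) \<in> r \<union> s \<union> X \<times> Y" for a b c
    using that sub assms(3) lin_order_trans[OF r, of a b c] lin_order_trans[OF s, of a b c]
    by blast
  show "(a, b) \<in> r \<union> s \<union> X \<times> Y \<or> (b, a) \<in> r \<union> s \<union> X \<times> Y"
    if "a \<in> X \<union> Y" "b \<in> X \<union> Y" "a \<noteq> b" for a b
    using that lin_order_total[OF r, of a b] lin_order_total[OF s, of a b] by blast
qed

lemma ex_lin_order: "finite X \<Longrightarrow> \<exists>r. lin_order X r"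
proof (induction X rule: finite_induct)
  case empty
  show ?case using lin_order_empty by blast
next
  case (insert a X)
  then obtain r where "lin_order X r" by blast
  then show ?case
    using lin_order_append[OF lin_order_singleton[of a], of X r] insert.hyps by auto
qed

lemma lin_order_restrict: "lin_order X r \<Longrightarrow> Y \<subseteq> X \<Longrightarrow> lin_order Y (r \<inter> Y \<times> Y)"
  by (rule lin_orderI)
    (auto dest: lin_order_irrefl lin_order_trans lin_order_total)

lemma lin_order_image:
  assumes r: "lin_order X r" and "inj_on \<pi> X"
  shows "lin_order (\<pi> ` X) (map_prod \<pi> \<pi> ` r)"
proof -
  note sub = lin_order_subset[OF r]
  have inj: "\<pi> a = \<pi> b \<longleftrightarrow> a = b" if "a \<in> X" "b \<in> X" for a b
    using assms(2) that by (auto dest: inj_onD)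
  show ?thesis
  proof (rule lin_orderI)
    show "map_prod \<pi> \<pi> ` r \<subseteq> \<pi> ` X \<times> \<pi> ` X"
      using sub by auto
    show "(a, a) \<notin> map_prod \<pi> \<pi> ` r" for a
      using lin_order_irrefl[OF r] sub inj by (auto simp: map_prod_def)
    show "(a, c) \<in> map_prod \<pi> \<pi> ` r"
      if ab: "(a, b) \<in> map_prod \<pi> \<pi> ` r" and bc: "(b, c) \<in> map_prod \<pi> \<pi> ` r" for a b c
    proof -
      obtain u v where uv: "(u, v) \<in> r" "a = \<pi> u" "b = \<pi> v" using ab by auto
      obtain v' t where vt: "(v', t) \<in> r" "b = \<pi> v'" "c = \<pi> t" using bc by auto
      have "v = v'" using uv vt sub inj[of v v'] by auto
      then have "(u, t) \<in> r" using uv vt lin_order_trans[OF r] by blast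
      then show ?thesis using uv vt by force
    qed
    show "(a, b) \<in> map_prod \<pi> \<pi> ` r \<or> (b, a) \<in> map_prod \<pi> \<pi> ` r"
      if "a \<in> \<pi> ` X" "b \<in> \<pi> ` X" "a \<noteq> b" for a b
      using that lin_order_total[OF r] by (auto simp: image_iff) force
  qed
qed

section \<open>Profiles and the effect of their changes on margins\<close>

lemma profile_finite: "is_profile P \<Longrightarrow> finite (voters P)"
  by (simp add: is_profile_def)

lemma profile_lin_order: "is_profile P \<Longrightarrow> i \<in> voters P \<Longrightarrow> lin_order (cands P) (ballot P i)"
  by (simp add: is_profile_def)

lemma margin_pos_in_cands:
  assumes "is_profile P" "margin P a b > 0"
  shows "a \<in> cands P" "b \<in> cands P"
proof -
  have "card {i \<in> voters P. (a, b) \<in> ballot P i} \<noteq> 0"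
    using assms(2) by (auto simp: margin_def)
  then obtain i where "i \<in> voters P" "(a, b) \<in> ballot P i"
    by (auto simp: card_eq_0_iff)
  then show "a \<in> cands P" "b \<in> cands P"
    using profile_lin_order[OF assms(1)] lin_order_subset by blast+
qed

text \<open>Each ballot ranks exactly one of the two above the other, so the two supporter counts
  sum to the number of voters and differ by the margin. Hence the margin fixes the parity of the
  number of voters and, for a given voter set, the number of supporters.\<close>

lemma card_supporters:
  assumes "is_profile P" "x \<in> cands P" "y \<in> cands P" "x \<noteq> y"
  shows "2 * int (card {i \<in> voters P. (x, y) \<in> ballot P i}) = int (card (voters P)) + margin P x y"
proof -
  have "voters P = {i \<in> voters P. (x, y) \<in> ballot P i} \<union> {i \<in> voters P. (y, x) \<in> ballot P i}"
    using assms lin_order_total profile_lin_order by fastforce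
  moreover have "{i \<in> voters P. (x, y) \<in> ballot P i} \<inter> {i \<in> voters P. (y, x) \<in> ballot P i} = {}"
    using assms lin_order_asym profile_lin_order by fastforce
  ultimately have "card (voters P) = card {i \<in> voters P. (x, y) \<in> ballot P i}
      + card {i \<in> voters P. (y, x) \<in> ballot P i}"
    using profile_finite[OF assms(1)] by (metis (no_types, lifting) card_Un_disjoint finite_Un)
  then show ?thesis by (simp add: margin_def)
qed

definition enlarge :: "('v, 'c) profile \<Rightarrow> 'v \<Rightarrow> ('c \<times> 'c) set \<Rightarrow> ('v, 'c) profile" where
  "enlarge P i r = \<lparr>voters = insert i (voters P), cands = cands P, ballot = (ballot P)(i := r)\<rparr>"

lemma enlarge_simps [simp]:
  "voters (enlarge P i r) = insert i (voters P)"
  "cands (enlarge P i r) = cands P"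
  "ballot (enlarge P i r) = (ballot P)(i := r)"
  by (simp_all add: enlarge_def)

lemma is_profile_enlarge:
  "is_profile P \<Longrightarrow> lin_order (cands P) r \<Longrightarrow> is_profile (enlarge P i r)"
  by (simp add: is_profile_def)

lemma margin_add_voter:
  assumes "finite (voters P)" "i \<notin> voters P"
    "voters Q = insert i (voters P)" "ballot Q = (ballot P)(i := r)"
  shows "margin Q a b = margin P a b + net r a b"
proof -
  have "(\<Sum>j\<in>voters P. net (ballot Q j) a b) = (\<Sum>j\<in>voters P. net (ballot P j) a b)"
    using assms by (intro sum.cong) auto
  then show ?thesis
    using assms by (simp add: margin_eq_sum)
qed

lemma margin_enlarge:
  assumes "is_profile P" "i \<notin> voters P"
  shows "margin (enlarge P i r) a b = margin P a b + net r a b"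
  by (rule margin_add_voter) (use assms profile_finite in auto)

lemma margin_permute:
  assumes "finite (voters P)" "voters Q = voters P" "bij_betw \<pi> (voters P) (voters P)"
    "\<And>i. i \<in> voters P \<Longrightarrow> ballot Q i = ballot P (\<pi> i)"
  shows "margin Q a b = margin P a b"
  using assms sum.reindex_bij_betw[OF assms(3), of "\<lambda>i. net (ballot P i) a b"]
  by (simp add: margin_eq_sum)

lemma margin_doubling:
  assumes "doubling P Q"
  shows "margin Q a b = 2 * margin P a b"
proof -
  obtain g where g: "\<And>j. j \<in> voters Q \<Longrightarrow> g j \<in> voters P \<and> ballot Q j = ballot P (g j)"
    and two: "\<And>i. i \<in> voters P \<Longrightarrow> card {j \<in> voters Q. g j = i} = 2"
    and P: "is_profile P" and Q: "is_profile Q"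
    using assms unfolding doubling_def by blast
  have fin: "finite (voters P)" "finite (voters Q)"
    using P Q profile_finite by auto
  have "margin Q a b = (\<Sum>j\<in>voters Q. net (ballot P (g j)) a b)"
    using g by (simp add: margin_eq_sum fin)
  \<comment> \<open>The sum is grouped by the fibres of \<open>g\<close>, each consisting of the two
    copies of one voter.\<close>
  also have "\<dots> = (\<Sum>i\<in>voters P. \<Sum>j\<in>{j \<in> voters Q. g j = i}. net (ballot P (g j)) a b)"
    using g by (intro sum.group[symmetric] fin) auto
  also have "\<dots> = (\<Sum>i\<in>voters P. 2 * net (ballot P i) a b)"
    using two by (intro sum.cong) auto
  finally show ?thesis
    by (simp add: margin_eq_sum fin sum_distrib_left)
qed

lemma margin_add_reversal:
  assumes "add_reversal P Q"
  shows "margin Q a b = margin P a b"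
proof -
  obtain i j r where ij: "i \<notin> voters P" "j \<notin> voters P" "i \<noteq> j" "lin_order (cands P) r"
    and Q: "voters Q = voters P \<union> {i, j}" "ballot Q = (ballot P)(i := r, j := r\<inverse>)"
    and P: "is_profile P"
    using assms unfolding add_reversal_def by blast
  have "margin Q a b = margin (enlarge P i r) a b + net (r\<inverse>) a b"
    by (rule margin_add_voter) (use ij Q P profile_finite in auto)
  then show ?thesis
    using ij P by (simp add: margin_enlarge net_converse)
qed

lemma margin_rename:
  assumes "finite (voters P)" "voters Q = voters P"
    "\<And>i. i \<in> voters P \<Longrightarrow> (a, b) \<in> ballot P i \<longleftrightarrow> (\<pi> a, \<pi> b) \<in> ballot Q i"
    "\<And>i. i \<in> voters P \<Longrightarrow> (b, a) \<in> ballot P i \<longleftrightarrow> (\<pi> b, \<pi> a) \<in> ballot Q i"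
  shows "margin Q (\<pi> a) (\<pi> b) = margin P a b"
  using assms by (simp add: margin_eq_sum net_def)

lemma is_profile_restrict:
  "is_profile P \<Longrightarrow> Y \<subseteq> cands P \<Longrightarrow> Y \<noteq> {} \<Longrightarrow> is_profile (restrict P Y)"
  unfolding is_profile_def restrict_def
  by (auto intro: lin_order_restrict finite_subset)

lemma margin_restrict: "a \<in> Y \<Longrightarrow> b \<in> Y \<Longrightarrow> margin (restrict P Y) a b = margin P a b"
  by (simp add: margin_def restrict_def)


section \<open>Split Cycle in terms of reachability\<close>

text \<open>The threshold graph at level \<open>m\<close>. For positive \<open>m\<close>, the
  majority paths of strength at least \<open>m\<close> are its walks with at least one edge, hence
  the transitive closure below.\<close>

definition strong :: "('v, 'c) profile \<Rightarrow> int \<Rightarrow> ('c \<times> 'c) set" where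
  "strong P m = {(a, b). margin P a b \<ge> m}"

lemma in_strong_iff [simp]: "(a, b) \<in> strong P m \<longleftrightarrow> margin P a b \<ge> m"
  by (simp add: strong_def)

lemma path_imp_trancl:
  assumes "length xs \<ge> 2" "\<And>k. k + 1 < length xs \<Longrightarrow> (xs ! k, xs ! (k + 1)) \<in> R"
  shows "(hd xs, last xs) \<in> R\<^sup>+"
  using assms
proof (induction xs)
  case Nil
  then show ?case by simp
next
  case (Cons a xs)
  have first: "(a, hd xs) \<in> R"
    using Cons.prems(1) Cons.prems(2)[of 0] by (cases xs) auto
  show ?case
  proof (cases "length xs \<ge> 2")
    case True
    have "(xs ! k, xs ! (k + 1)) \<in> R" if "k + 1 < length xs" for k
      using Cons.prems(2)[of "k + 1"] that by simp
    with True Cons.IH have "(hd xs, last xs) \<in> R\<^sup>+" by blast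
    then show ?thesis
      using first True by (auto intro: trancl_into_trancl2)
  next
    case False
    then obtain b where "xs = [b]"
      using Cons.prems(1) by (cases xs) (auto simp: Suc_le_eq)
    then show ?thesis using first by auto
  qed
qed

lemma trancl_imp_path:
  assumes "(a, b) \<in> R\<^sup>+"
  shows "\<exists>xs. length xs \<ge> 2 \<and> hd xs = a \<and> last xs = b \<and>
    (\<forall>k. k + 1 < length xs \<longrightarrow> (xs ! k, xs ! (k + 1)) \<in> R)"
  using assms
proof (induction rule: trancl_induct)
  case (base b)
  then show ?case by (intro exI[of _ "[a, b]"]) auto
next
  case (step b c)
  then obtain xs where xs: "length xs \<ge> 2" "hd xs = a" "last xs = b"
    "\<And>k. k + 1 < length xs \<Longrightarrow> (xs ! k, xs ! (k + 1)) \<in> R"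
    by blast
  have "((xs @ [c]) ! k, (xs @ [c]) ! (k + 1)) \<in> R" if "k + 1 < length (xs @ [c])" for k
  proof (cases "k + 1 < length xs")
    case True
    then show ?thesis using xs(4)[of k] by (simp add: nth_append)
  next
    case False
    then have k: "k + 1 = length xs" using that by simp
    have "xs ! k = b"
      using xs(1,3) k by (metis add_diff_cancel_right' last_conv_nth list.size(3) not_numeral_le_zero)
    then have "(xs @ [c]) ! k = b" "(xs @ [c]) ! (k + 1) = c"
      using k by (simp add: nth_append, metis nth_append_length)
    then show ?thesis
      using step.hyps(2) by simp
  qed
  then show ?case
    using xs by (intro exI[of _ "xs @ [c]"]) (auto simp: hd_append)
qed

text \<open>With at least two entries there is an edge, so the minimum is taken over a nonempty
  finite set.\<close>

lemma strength_ge_iff: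
  assumes "length xs \<ge> 2"
  shows "m \<le> strength P xs \<longleftrightarrow> (\<forall>k. k + 1 < length xs \<longrightarrow> margin P (xs ! k) (xs ! (k + 1)) \<ge> m)"
proof -
  let ?S = "{margin P (xs ! k) (xs ! (k + 1)) | k. k + 1 < length xs}"
  have eq: "?S = (\<lambda>k. margin P (xs ! k) (xs ! (k + 1))) ` {..<length xs - 1}"
    by (auto simp: image_iff)
  have "finite ?S" "?S \<noteq> {}"
    unfolding eq using assms by (auto simp: lessThan_empty_iff)
  then show ?thesis
    unfolding strength_def by (subst Min_ge_iff) auto
qed

lemma strong_path_iff:
  assumes "m > 0"
  shows "(\<exists>xs. majority_path P xs \<and> hd xs = y \<and> last xs = x \<and> m \<le> strength P xs)
    \<longleftrightarrow> (y, x) \<in> (strong P m)\<^sup>+"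
proof
  assume "\<exists>xs. majority_path P xs \<and> hd xs = y \<and> last xs = x \<and> m \<le> strength P xs"
  then show "(y, x) \<in> (strong P m)\<^sup>+"
    using path_imp_trancl[of _ "strong P m"] by (auto simp: majority_path_def strength_ge_iff)
next
  assume "(y, x) \<in> (strong P m)\<^sup>+"
  then obtain xs where "length xs \<ge> 2" "hd xs = y" "last xs = x"
    "\<forall>k. k + 1 < length xs \<longrightarrow> margin P (xs ! k) (xs ! (k + 1)) \<ge> m"
    using trancl_imp_path by fastforce
  with assms show "\<exists>xs. majority_path P xs \<and> hd xs = y \<and> last xs = x \<and> m \<le> strength P xs"
    by (intro exI[of _ xs]) (auto simp: majority_path_def strength_ge_iff intro: less_le_trans)
qed

text \<open>A path whose strength is not exceeded by the margin is one that stays in the threshold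
  graph of the margin itself; positivity of the margin makes the edges of that graph majority
  edges.\<close>

lemma sc_iff:
  "(x, y) \<in> sc P \<longleftrightarrow> margin P x y > 0 \<and> (y, x) \<notin> (strong P (margin P x y))\<^sup>+"
proof (cases "margin P x y > 0")
  case True
  have "(x, y) \<in> sc P \<longleftrightarrow> \<not> (\<exists>xs. majority_path P xs \<and> hd xs = y \<and> last xs = x
      \<and> margin P x y \<le> strength P xs)"
    using True by (auto simp: sc_def not_le)
  then show ?thesis
    using True strong_path_iff by metis
qed (simp add: sc_def)

text \<open>Split Cycle only uses the signs of margins and comparisons between them. The factor 1
  serves permuted voters and reversal pairs, the factor 2 doubling.\<close>

lemma sc_eq_of_margin_scale:
  assumes "k > 0" "\<And>a b. margin Q a b = k * margin P a b"
  shows "sc Q = sc P"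
proof -
  have "strong Q (k * m) = strong P m" for m
    using assms by (auto simp: strong_def)
  then show ?thesis
    using assms by (auto simp: sc_iff zero_less_mult_iff)
qed

text \<open>Positivity of \<open>m\<close> confines every edge to the candidates of
  \<open>P\<close>, where the margins are known to correspond.\<close>

lemma trancl_strong_rename:
  assumes "(a, b) \<in> (strong P m)\<^sup>+" "m > 0" "is_profile P"
    "\<And>a b. a \<in> cands P \<Longrightarrow> b \<in> cands P \<Longrightarrow> margin Q (\<pi> a) (\<pi> b) = margin P a b"
  shows "(\<pi> a, \<pi> b) \<in> (strong Q m)\<^sup>+"
proof -
  have edge: "(\<pi> a, \<pi> b) \<in> strong Q m" if "(a, b) \<in> strong P m" for a b
    using that assms(2-4) margin_pos_in_cands[of P a b] by auto
  from assms(1) show ?thesis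
  proof (induction rule: trancl_induct)
    case (base b)
    then show ?case using edge by blast
  next
    case (step b c)
    then show ?case using edge by (meson trancl_into_trancl)
  qed
qed

section \<open>Split Cycle satisfies the axioms\<close>

lemma vccr_sc: "vccr sc"
  unfolding vccr_def
  using margin_pos_in_cands margin_swap by (fastforce simp: sc_iff)

lemma anonymity_sc: "anonymity sc"
  unfolding anonymity_def
proof (intro allI impI, elim conjE)
  fix P Q :: "('v, 'c) profile" and \<pi>
  assume "is_profile P" "voters Q = voters P" "bij_betw \<pi> (voters P) (voters P)"
    "\<forall>i\<in>voters P. ballot Q i = ballot P (\<pi> i)"
  then have "margin Q a b = margin P a b" for a b
    by (intro margin_permute[of P Q \<pi>]) (auto simp: profile_finite)
  then show "sc P = sc Q"
    using sc_eq_of_margin_scale[of 1 Q P] by simp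
qed

lemma neutrality_sc: "neutrality sc"
  unfolding neutrality_def
proof (intro allI impI ballI, elim conjE)
  fix P Q :: "('v, 'c) profile" and \<pi> x y
  assume P: "is_profile P" and Q: "is_profile Q"
    and V: "voters Q = voters P" and C: "cands Q = cands P"
    and \<pi>: "bij_betw \<pi> (cands P) (cands P)"
    and xy: "x \<in> cands P" "y \<in> cands P"
    and B: "\<forall>i\<in>voters P. \<forall>x\<in>cands P. \<forall>y\<in>cands P.
      (x, y) \<in> ballot P i \<longleftrightarrow> (\<pi> x, \<pi> y) \<in> ballot Q i"
  have marg: "margin Q (\<pi> a) (\<pi> b) = margin P a b" if "a \<in> cands P" "b \<in> cands P" for a b
    using that B by (intro margin_rename profile_finite P V) auto
  \<comment> \<open>The inverse permutation carries paths of \<open>Q\<close> back to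
    \<open>P\<close>, since renaming transports paths in one direction only.\<close>
  define \<rho> where "\<rho> = inv_into (cands P) \<pi>"
  have \<rho>: "\<rho> c \<in> cands P" "\<pi> (\<rho> c) = c" if "c \<in> cands P" for c
    using \<pi> that unfolding \<rho>_def bij_betw_def by (auto intro: inv_into_into f_inv_into_f)
  have \<rho>': "\<rho> (\<pi> c) = c" if "c \<in> cands P" for c
    using \<pi> that unfolding \<rho>_def bij_betw_def by simp
  have marg': "margin P (\<rho> a) (\<rho> b) = margin Q a b" if "a \<in> cands Q" "b \<in> cands Q" for a b
    using marg[of "\<rho> a" "\<rho> b"] \<rho> that C by simp
  have "(y, x) \<in> (strong P m)\<^sup>+ \<longleftrightarrow> (\<pi> y, \<pi> x) \<in> (strong Q m)\<^sup>+" if "m > 0" for m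
    using trancl_strong_rename[of y x P m Q \<pi>] trancl_strong_rename[of "\<pi> y" "\<pi> x" Q m P \<rho>]
      marg marg' that P Q \<rho>' xy by auto
  then show "(x, y) \<in> sc P \<longleftrightarrow> (\<pi> x, \<pi> y) \<in> sc Q"
    using marg xy by (auto simp: sc_iff)
qed

text \<open>Here \<open>(c, d)\<close> is an edge of minimal margin on a defeat path; if the path is a cycle, its
remaining edges block the defeat of \<open>d\<close> by \<open>c\<close>.\<close>
lemma trancl_sc_min_edge:
  assumes "(a, b) \<in> (sc P)\<^sup>+"
  shows "\<exists>c d. (c, d) \<in> sc P \<and> (a, c) \<in> (strong P (margin P c d))\<^sup>*
    \<and> (d, b) \<in> (strong P (margin P c d))\<^sup>*"
  using assms
proof (induction rule: trancl_induct)
  case (base b)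
  then show ?case by blast
next
  case (step b e)
  then obtain c d where cd: "(c, d) \<in> sc P" "(a, c) \<in> (strong P (margin P c d))\<^sup>*"
    "(d, b) \<in> (strong P (margin P c d))\<^sup>*"
    by blast
  show ?case
  proof (cases "margin P c d \<le> margin P b e")
    case True
    then have "(d, e) \<in> (strong P (margin P c d))\<^sup>*"
      using cd(3) by (meson in_strong_iff rtrancl.rtrancl_into_rtrancl)
    then show ?thesis using cd by blast
  next
    case False
    then have sub: "strong P (margin P c d) \<subseteq> strong P (margin P b e)"
      by auto
    have "(a, c) \<in> (strong P (margin P b e))\<^sup>*" "(d, b) \<in> (strong P (margin P b e))\<^sup>*"
      using cd rtrancl_mono[OF sub] by auto
    moreover have "(c, d) \<in> strong P (margin P b e)"
      using False by simp
    ultimately have "(a, b) \<in> (strong P (margin P b e))\<^sup>*"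
      by (meson rtrancl.rtrancl_into_rtrancl rtrancl_trans)
    then show ?thesis using step.hyps(2) by blast
  qed
qed

lemma acyclic_sc: "acyclic (sc P)"
proof (rule acyclicI, intro allI notI)
  fix a assume "(a, a) \<in> (sc P)\<^sup>+"
  then obtain c d where cd: "(c, d) \<in> sc P" "(d, c) \<in> (strong P (margin P c d))\<^sup>*"
    using trancl_sc_min_edge by (meson rtrancl_trans)
  moreover have "d \<noteq> c" using cd(1) by (auto simp: sc_iff)
  ultimately show False
    by (auto simp: sc_iff rtrancl_eq_or_trancl)
qed

text \<open>A finite acyclic defeat relation is well-founded, and a minimal candidate is
  undefeated.\<close>

lemma availability_sc: "availability sc"
  unfolding availability_def
proof (intro allI impI)
  fix P :: "('v, 'c) profile" assume P: "is_profile P"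
  have sub: "sc P \<subseteq> cands P \<times> cands P"
    using P vccr_sc unfolding vccr_def by blast
  then have "wf (sc P)"
    using P acyclic_sc
    by (intro finite_acyclic_wf) (auto simp: is_profile_def intro: finite_subset)
  moreover obtain c where "c \<in> cands P"
    using P by (auto simp: is_profile_def)
  ultimately obtain z where "z \<in> cands P" "\<And>y. (y, z) \<in> sc P \<Longrightarrow> y \<notin> cands P"
    by (rule wfE_min) blast
  then show "\<exists>x\<in>cands P. \<forall>y. (y, x) \<notin> sc P"
    using sub by blast
qed

lemma homogeneity_sc: "homogeneity sc"
  unfolding homogeneity_def
  by (intro allI impI sc_eq_of_margin_scale[of 2, symmetric]) (simp_all add: margin_doubling)

lemma neutral_reversal_sc: "neutral_reversal sc"
  unfolding neutral_reversal_def
  by (intro allI impI sc_eq_of_margin_scale[of 1, symmetric]) (simp_all add: margin_add_reversal)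

text \<open>A single ballot changes, only on the pair of \<open>x\<close> and its neighbour
  \<open>z\<close>, and in favour of \<open>x\<close>; so no other candidate gains against
  anyone.\<close>

lemma margin_one_up:
  assumes "one_up P Q x" "a \<noteq> x"
  shows "margin Q a b \<le> margin P a b" "margin Q b a \<ge> margin P b a"
proof -
  obtain i z where P: "is_profile P" and V: "voters Q = voters P" and i: "i \<in> voters P"
    and z: "(z, x) \<in> ballot P i"
    and B: "ballot Q = (ballot P)(i := (ballot P i - {(z, x)}) \<union> {(x, z)})"
    using assms(1) unfolding one_up_def by blast
  have "(x, z) \<notin> ballot P i"
    using lin_order_asym[OF profile_lin_order[OF P i] z] .
  then have "net (ballot Q j) a b \<le> net (ballot P j) a b" for j
    using B assms(2) z by (auto simp: net_def)
  then show "margin Q a b \<le> margin P a b"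
    using profile_finite[OF P] V by (auto simp: margin_eq_sum intro: sum_mono)
  then show "margin Q b a \<ge> margin P b a"
    using margin_swap[of P a b] margin_swap[of Q a b] by simp
qed

text \<open>A path into \<open>x\<close> may be cut at its first visit of \<open>x\<close>, so only edges that do not start
at \<open>x\<close> matter.\<close>
lemma trancl_avoid_source:
  assumes "(y, x) \<in> R\<^sup>+" "y \<noteq> x"
  shows "(y, x) \<in> {(a, b) \<in> R. a \<noteq> x}\<^sup>+"
  using assms
proof (induction rule: converse_trancl_induct)
  case (base y)
  then show ?case by auto
next
  case (step y z)
  then show ?case
    by (cases "z = x") (auto intro: trancl_into_trancl2)
qed

text \<open>Raising \<open>x\<close> neither lowers its margin over \<open>y\<close> nor increases
  the margin on an edge starting elsewhere. A path blocking the defeat afterwards, cut at its first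
  visit of \<open>x\<close>, therefore blocked it before.\<close>

lemma monotonicity_sc: "monotonicity sc"
  unfolding monotonicity_def
proof (intro allI impI, elim conjE)
  fix P Q :: "('v, 'c) profile" and x y
  assume up: "one_up P Q x" and xy: "(x, y) \<in> sc P"
  have "x \<noteq> y" using xy by (auto simp: sc_iff)
  then have le: "margin P x y \<le> margin Q x y"
    using margin_one_up(2)[OF up] by simp
  have "(y, x) \<notin> (strong Q (margin Q x y))\<^sup>+"
  proof
    assume "(y, x) \<in> (strong Q (margin Q x y))\<^sup>+"
    then have "(y, x) \<in> {(a, b) \<in> strong Q (margin Q x y). a \<noteq> x}\<^sup>+"
      using trancl_avoid_source \<open>x \<noteq> y\<close> by fast
    moreover have "{(a, b) \<in> strong Q (margin Q x y). a \<noteq> x} \<subseteq> strong P (margin P x y)"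
      using margin_one_up(1)[OF up] le by clarsimp (meson order_trans)
    ultimately have "(y, x) \<in> (strong P (margin P x y))\<^sup>+"
      using trancl_mono by blast
    then show False using xy by (simp add: sc_iff)
  qed
  then show "(x, y) \<in> sc Q"
    using le xy by (simp add: sc_iff)
qed

lemma trancl_strong_mono:
  assumes "(a, b) \<in> (strong P m)\<^sup>+"
    and "\<And>c d. margin P c d \<ge> m \<Longrightarrow> margin Q c d \<ge> m'"
  shows "(a, b) \<in> (strong Q m')\<^sup>+"
proof -
  have "strong P m \<subseteq> strong Q m'"
    using assms(2) by (auto simp: strong_def)
  with assms(1) show ?thesis by (rule trancl_mono)
qed

text \<open>Every edge of \<open>Q\<close> at least as strong as the defeat was already that strong
  in \<open>P\<close>, so a blocking path in \<open>Q\<close> would block in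
  \<open>P\<close>.\<close>

lemma coherent_IIA_sc: "coherent_IIA sc"
  unfolding coherent_IIA_def
proof (intro allI impI, elim conjE)
  fix P Q :: "('v, 'c) profile" and x y
  assume xy: "(x, y) \<in> sc P" and step: "ciia_step P x y Q"
  have eq: "margin Q x y = margin P x y" and Q: "is_profile Q"
    using step by (auto simp: ciia_step_def)
  have le: "margin P c d \<ge> margin P x y" if "margin Q c d \<ge> margin P x y" for c d
  \<comment> \<open>The weight condition does not speak of the edge between \<open>x\<close> and
    \<open>y\<close>; there the margins agree, in both orientations.\<close>
  proof (cases "{c, d} = {x, y}")
    case True
    then show ?thesis
      using that eq margin_swap[of P x y] margin_swap[of Q x y] by (auto simp: doubleton_eq_iff)
  next
    case False
    have pos: "margin Q c d > 0" using that xy by (simp add: sc_iff)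
    then have "c \<in> cands Q" "d \<in> cands Q"
      using margin_pos_in_cands[OF Q] by auto
    then have "margin Q c d \<le> margin P c d"
      using step pos False unfolding ciia_step_def by blast
    then show ?thesis using that by simp
  qed
  show "(x, y) \<in> sc Q"
    using xy trancl_strong_mono[of y x Q "margin P x y" "margin P x y" P] le
    by (auto simp: sc_iff eq)
qed

lemma coherent_defeat_sc: "coherent_defeat sc"
  unfolding coherent_defeat_def by (auto simp: sc_def)

text \<open>The new ballot lowers the margin of \<open>x\<close> over \<open>y\<close> by exactly 1
  and any other margin by at most 1, so a path that blocked the defeat remains strong
  enough.\<close>

lemma positive_involvement_defeat_sc: "positive_involvement_defeat sc"
  unfolding positive_involvement_defeat_def
proof (intro allI impI, elim conjE)
  fix P Q :: "('v, 'c) profile" and i r x y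
  assume xy: "(x, y) \<notin> sc P" and add: "add_voter P i r Q" and r: "(y, x) \<in> r"
  have marg: "margin Q a b = margin P a b + net r a b" for a b
    using add by (intro margin_add_voter) (auto simp: add_voter_def profile_finite)
  have "(x, y) \<notin> r"
    using add r lin_order_asym[of "cands P" r y x] by (simp add: add_voter_def)
  then have less: "margin Q x y = margin P x y - 1"
    using r by (simp add: marg net_def)
  show "(x, y) \<notin> sc Q"
  proof (cases "margin P x y > 0")
    case True
    then have "(y, x) \<in> (strong P (margin P x y))\<^sup>+"
      using xy by (simp add: sc_iff)
    moreover have "margin Q c d \<ge> margin Q x y" if "margin P c d \<ge> margin P x y" for c d
      using that less marg[of c d] abs_net_le[of r c d] by linarith
    ultimately have "(y, x) \<in> (strong Q (margin Q x y))\<^sup>+"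
      by (rule trancl_strong_mono)
    then show ?thesis by (simp add: sc_iff)
  qed (simp add: sc_iff less)
qed

section \<open>Realizing margin graphs\<close>

lemma infinite_UNIV_fresh:
  assumes "infinite (UNIV :: 'a set)" "finite A"
  obtains i :: 'a where "i \<notin> A"
  using assms ex_new_if_finite by blast

text \<open>One ballot and its reverse cancel on every pair. This is the starting point for
  prescribing margins.\<close>

lemma ex_reversal_pair:
  fixes C :: "'c set"
  assumes inf: "infinite (UNIV :: 'v set)" and C: "finite C" "C \<noteq> {}"
  shows "\<exists>P :: ('v, 'c) profile. is_profile P \<and> cands P = C \<and> (\<forall>a b. margin P a b = 0)"
proof -
  obtain r where r: "lin_order C r"
    using C ex_lin_order by blast
  obtain i :: 'v where True by blast
  obtain j where "j \<notin> {i}"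
    by (rule infinite_UNIV_fresh[OF inf, of "{i}"]) auto
  define P0 :: "('v, 'c) profile"
    where "P0 = \<lparr>voters = {i}, cands = C, ballot = (\<lambda>_. {})(i := r)\<rparr>"
  have P0: "is_profile P0"
    using C r by (simp add: P0_def is_profile_def)
  have m0: "margin P0 a b = net r a b" for a b
    by (simp add: margin_eq_sum P0_def)
  have "margin (enlarge P0 j (r\<inverse>)) a b = 0" for a b
    using P0 m0 \<open>j \<notin> {i}\<close> by (subst margin_enlarge) (auto simp: P0_def net_converse)
  moreover have "is_profile (enlarge P0 j (r\<inverse>))"
    using P0 r by (intro is_profile_enlarge) (auto simp: P0_def intro: lin_order_converse)
  ultimately show ?thesis
    by (intro exI[of _ "enlarge P0 j (r\<inverse>)"]) (auto simp: P0_def)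
qed

text \<open>McGarvey's two voters: \<open>a b rest\<close> and \<open>rev(rest) a b\<close>.\<close>
lemma ex_margin_increment:
  fixes P :: "('v, 'c) profile"
  assumes inf: "infinite (UNIV :: 'v set)" and P: "is_profile P"
    and ab: "a \<in> cands P" "b \<in> cands P" "a \<noteq> b"
  shows "\<exists>Q :: ('v, 'c) profile. is_profile Q \<and> cands Q = cands P
    \<and> (\<forall>c\<in>cands P. \<forall>d\<in>cands P. margin Q c d = margin P c d + 2 * net {(a, b)} c d)"
proof -
  define Y where "Y = cands P - {a, b}"
  have C: "cands P = {a, b} \<union> Y" "cands P = Y \<union> {a, b}"
    using ab by (auto simp: Y_def)
  have top: "lin_order {a, b} {(a, b)}"
    using ab by (intro lin_orderI) auto
  have "finite Y" using P by (simp add: Y_def is_profile_def)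
  then obtain r where r: "lin_order Y r" using ex_lin_order by blast
  define r1 where "r1 = {(a, b)} \<union> r \<union> {a, b} \<times> Y"
  define r2 where "r2 = r\<inverse> \<union> {(a, b)} \<union> Y \<times> {a, b}"
  have r1: "lin_order (cands P) r1"
    unfolding C(1) r1_def by (rule lin_order_append[OF top r]) (auto simp: Y_def)
  have r2: "lin_order (cands P) r2"
    unfolding C(2) r2_def
    by (rule lin_order_append[OF lin_order_converse[OF r] top]) (auto simp: Y_def)
  have sum: "net r1 c d + net r2 c d = 2 * net {(a, b)} c d"
    if "c \<in> cands P" "d \<in> cands P" for c d
  proof -
    have rY: "\<And>u v. (u, v) \<in> r \<Longrightarrow> u \<in> Y \<and> v \<in> Y" and ab': "a \<notin> Y" "b \<notin> Y"
      using lin_order_subset[OF r] by (auto simp: Y_def)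
    from that consider "c \<in> Y" "d \<in> Y" | "c \<in> Y" "d \<in> {a, b}" | "c \<in> {a, b}" "d \<in> Y"
      | "c \<in> {a, b}" "d \<in> {a, b}"
      by (auto simp: Y_def)
    then show ?thesis
    proof cases
      case 1
      then have "c \<noteq> a" "c \<noteq> b" "d \<noteq> a" "d \<noteq> b" using ab' by auto
      then show ?thesis by (simp add: net_def r1_def r2_def)
    qed (use rY ab ab' in \<open>auto simp: net_def r1_def r2_def\<close>)
  qed
  obtain i where i: "i \<notin> voters P"
    by (rule infinite_UNIV_fresh[OF inf profile_finite[OF P]])
  obtain j where j: "j \<notin> insert i (voters P)"
    by (rule infinite_UNIV_fresh[OF inf, of "insert i (voters P)"]) (use profile_finite[OF P] in auto)
  have P1: "is_profile (enlarge P i r1)"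
    using P r1 by (rule is_profile_enlarge)
  have "is_profile (enlarge (enlarge P i r1) j r2)"
    using P1 r2 by (simp add: is_profile_enlarge)
  moreover have "margin (enlarge (enlarge P i r1) j r2) c d
      = margin P c d + (net r1 c d + net r2 c d)" for c d
    using P P1 i j by (simp add: margin_enlarge)
  ultimately show ?thesis
    using sum by (intro exI[of _ "enlarge (enlarge P i r1) j r2"]) auto
qed

text \<open>McGarvey's theorem for even weights, by induction on the total absolute weight: each
  added pair of voters accounts for 2 units on one edge.\<close>

lemma ex_profile_margins:
  fixes C :: "'c set" and w :: "'c \<Rightarrow> 'c \<Rightarrow> int"
  assumes inf: "infinite (UNIV :: 'v set)" and C: "finite C" "C \<noteq> {}"
    and anti: "\<And>a b. w b a = - w a b" and ev: "\<And>a b. even (w a b)"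
  shows "\<exists>P :: ('v, 'c) profile. is_profile P \<and> cands P = C
    \<and> (\<forall>a\<in>C. \<forall>b\<in>C. margin P a b = w a b)"
  using anti ev
proof (induction "\<Sum>(a, b)\<in>C \<times> C. nat \<bar>w a b\<bar>" arbitrary: w rule: less_induct)
  case less
  show ?case
  proof (cases "\<exists>a\<in>C. \<exists>b\<in>C. w a b > 0")
    case False
    have "w a b = 0" if "a \<in> C" "b \<in> C" for a b
      using False that less.prems(1)[of a b]
      by (metis linorder_neqE_linordered_idom neg_0_less_iff_less neg_less_0_iff_less)
    then show ?thesis
      using ex_reversal_pair[OF inf C] by metis
  next
    case True
    then obtain a b where ab: "a \<in> C" "b \<in> C" "w a b > 0" by blast
    \<comment> \<open>An even positive weight is at least 2, so subtracting 2 does not overshoot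
      zero and the total absolute weight drops.\<close>
    have "w a b \<ge> 2" using less.prems(2)[of a b] ab(3) by presburger
    have "a \<noteq> b" using less.prems(1)[of a a] ab(3) by auto
    define w' where "w' c d = w c d - 2 * net {(a, b)} c d" for c d
    have le: "nat \<bar>w' c d\<bar> \<le> nat \<bar>w c d\<bar>" for c d
      using \<open>w a b \<ge> 2\<close> less.prems(1)[of a b] \<open>a \<noteq> b\<close> by (auto simp: w'_def net_def)
    have lt: "nat \<bar>w' a b\<bar> < nat \<bar>w a b\<bar>"
      using \<open>w a b \<ge> 2\<close> \<open>a \<noteq> b\<close> by (auto simp: w'_def net_def)
    have "(\<Sum>(a, b)\<in>C \<times> C. nat \<bar>w' a b\<bar>) < (\<Sum>(a, b)\<in>C \<times> C. nat \<bar>w a b\<bar>)"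
      using C ab le lt
      by (intro sum_strict_mono_ex1 ballI bexI[of _ "(a, b)"]) auto
    moreover have "w' d c = - w' c d" "even (w' c d)" for c d
      using less.prems(1)[of c d] less.prems(2)[of c d] by (auto simp: w'_def net_def)
    ultimately obtain P :: "('v, 'c) profile" where P: "is_profile P" "cands P = C"
      "\<forall>c\<in>C. \<forall>d\<in>C. margin P c d = w' c d"
      using less.hyps[of w'] by blast
    then show ?thesis
      using ex_margin_increment[OF inf P(1), of a b] ab \<open>a \<noteq> b\<close> by (auto simp: w'_def)
  qed
qed

lemma ex_doubling:
  fixes P :: "('v, 'c) profile"
  assumes inf: "infinite (UNIV :: 'v set)" and P: "is_profile P"
  shows "\<exists>Q. doubling P Q"
proof -
  have fin: "finite (voters P)" using P by (rule profile_finite)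
  have "infinite (UNIV - voters P)" using inf fin by simp
  then obtain W where W: "W \<subseteq> UNIV - voters P" "finite W" "card W = card (voters P)"
    by (meson infinite_arbitrarily_large)
  then obtain h where h: "bij_betw h W (voters P)"
    using fin finite_same_card_bij by blast
  define g where "g j = (if j \<in> W then h j else j)" for j
  define Q where "Q = \<lparr>voters = voters P \<union> W, cands = cands P,
    ballot = (\<lambda>j. if j \<in> voters P \<union> W then ballot P (g j) else {})\<rparr>"
  have g: "g j \<in> voters P" if "j \<in> voters P \<union> W" for j
    using that h by (auto simp: g_def bij_betw_def)
  have "is_profile Q"
    using P W(2) g by (auto simp: Q_def is_profile_def)
  moreover have "card {j \<in> voters Q. g j = i} = 2" if "i \<in> voters P" for i
  proof -
    have "i \<in> h ` W" using h that by (simp add: bij_betw_def)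
    then obtain k where k: "k \<in> W" "h k = i" by blast
    have "{j \<in> voters Q. g j = i} = {i, k}"
      using k that W(1) h by (auto simp: Q_def g_def bij_betw_def inj_on_def)
    moreover have "i \<noteq> k" using k W(1) that by auto
    ultimately show ?thesis by simp
  qed
  ultimately show ?thesis
    using P g unfolding doubling_def by (intro exI[of _ Q]) (auto simp: Q_def intro!: exI[of _ g])
qed

definition rename :: "('c \<Rightarrow> 'c) \<Rightarrow> ('v, 'c) profile \<Rightarrow> ('v, 'c) profile" where
  "rename \<pi> P = \<lparr>voters = voters P, cands = \<pi> ` cands P,
    ballot = (\<lambda>i. map_prod \<pi> \<pi> ` ballot P i)\<rparr>"

lemma rename_simps [simp]:
  "voters (rename \<pi> P) = voters P"
  "cands (rename \<pi> P) = \<pi> ` cands P"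
  by (simp_all add: rename_def)

lemma is_profile_rename:
  assumes "is_profile P" "inj_on \<pi> (cands P)"
  shows "is_profile (rename \<pi> P)"
  using assms by (auto simp: is_profile_def rename_def lin_order_image)

lemma in_rename_ballot_iff:
  assumes "is_profile P" "inj_on \<pi> (cands P)" "i \<in> voters P" "a \<in> cands P" "b \<in> cands P"
  shows "(\<pi> a, \<pi> b) \<in> ballot (rename \<pi> P) i \<longleftrightarrow> (a, b) \<in> ballot P i"
proof
  assume "(\<pi> a, \<pi> b) \<in> ballot (rename \<pi> P) i"
  then obtain c d where cd: "(c, d) \<in> ballot P i" "\<pi> c = \<pi> a" "\<pi> d = \<pi> b"
    by (auto simp: rename_def)
  then have "c \<in> cands P" "d \<in> cands P"
    using lin_order_subset[OF profile_lin_order[OF assms(1,3)]] by auto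
  then have "c = a" "d = b"
    using inj_onD[OF assms(2) cd(2)] inj_onD[OF assms(2) cd(3)] assms(4,5) by auto
  then show "(a, b) \<in> ballot P i"
    using cd(1) by simp
next
  assume "(a, b) \<in> ballot P i"
  then show "(\<pi> a, \<pi> b) \<in> ballot (rename \<pi> P) i"
    unfolding rename_def by (simp add: rev_image_eqI[of "(a, b)"])
qed

section \<open>The axioms force Split Cycle\<close>

text \<open>A shortest walk repeats no vertex, because the loop between two visits could be cut
  out.\<close>

lemma rtrancl_imp_simple_path:
  assumes "(a, b) \<in> R\<^sup>*"
  shows "\<exists>n z. z 0 = a \<and> z n = b \<and> inj_on z {..n} \<and> (\<forall>i<n. (z i, z (Suc i)) \<in> R)"
proof -
  define n where "n = (LEAST n. (a, b) \<in> R ^^ n)"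
  have "(a, b) \<in> R ^^ n"
    using assms unfolding n_def rtrancl_power by (rule LeastI_ex)
  then obtain z where z: "z 0 = a" "z n = b" "\<And>i. i < n \<Longrightarrow> (z i, z (Suc i)) \<in> R"
    unfolding relpow_fun_conv by blast
  have seg: "(z i, z j) \<in> R ^^ (j - i)" if "i \<le> j" "j \<le> n" for i j
    unfolding relpow_fun_conv using that z(3) by (intro exI[of _ "\<lambda>l. z (i + l)"]) simp
  have "z i \<noteq> z j" if "i < j" "j \<le> n" for i j
  proof
    assume "z i = z j"
    then have "(z 0, z n) \<in> R ^^ i O R ^^ (n - j)"
      using seg[of 0 i] seg[of j n] that by auto
    then have "(a, b) \<in> R ^^ (i + (n - j))"
      using z(1,2) by (simp add: relpow_add)
    then have "n \<le> i + (n - j)"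
      unfolding n_def by (rule Least_le)
    then show False using that by simp
  qed
  then have "inj_on z {..n}"
    unfolding inj_on_def by (metis atMost_iff linorder_neqE_nat)
  then show ?thesis using z by blast
qed

text \<open>The axioms on \<open>f\<close> are collected once. The infinite supply of voters
  provides fresh ones for copies, reversal pairs and opponents.\<close>

locale defeat_axioms =
  fixes f :: "('v, 'c) profile \<Rightarrow> ('c \<times> 'c) set"
  assumes inf: "infinite (UNIV :: 'v set)"
    and vccr: "vccr f" and anon: "anonymity f" and neut: "neutrality f"
    and avail: "availability f" and uphom: "upward_homogeneity f"
    and mono2: "monotonicity_two f" and nrev: "neutral_reversal f"
    and ciia: "coherent_IIA f" and cdef: "coherent_defeat f"
    and pid: "positive_involvement_defeat f"
begin

section \<open>Transfer of defeats between profiles\<close>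

lemma defeat_in_cands: "is_profile P \<Longrightarrow> (x, y) \<in> f P \<Longrightarrow> x \<in> cands P \<and> y \<in> cands P"
  using vccr unfolding vccr_def by blast

lemma defeat_asym: "is_profile P \<Longrightarrow> (x, y) \<in> f P \<Longrightarrow> (y, x) \<notin> f P"
  using vccr unfolding vccr_def by blast

text \<open>Reversal pairs use up \<open>D\<close> two voters at a time and leave margins and
  defeats as they are; hence the even size of \<open>D\<close>.\<close>

lemma ex_extend_voters:
  assumes "finite D" "even (card D)" "is_profile P" "D \<inter> voters P = {}"
  shows "\<exists>Q. is_profile Q \<and> voters Q = voters P \<union> D \<and> cands Q = cands P
    \<and> (\<forall>a b. margin Q a b = margin P a b) \<and> f Q = f P"
  using assms
proof (induction "card D" arbitrary: D P rule: less_induct)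
  case less
  show ?case
  proof (cases "D = {}")
    case True
    then show ?thesis using less.prems by auto
  next
    case False
    then obtain i where i: "i \<in> D" by blast
    \<comment> \<open>By parity, \<open>D\<close> cannot consist of \<open>i\<close> alone.\<close>
    have "card (D - {i}) \<noteq> 0"
      using i less.prems(1,2) by (metis card_Suc_Diff1 even_Suc even_zero)
    then obtain j where j: "j \<in> D" "j \<noteq> i"
      by (metis Diff_iff card.empty ex_in_conv insertI1)
    obtain r where r: "lin_order (cands P) r"
      using less.prems(3) ex_lin_order unfolding is_profile_def by blast
    define Q where "Q = enlarge (enlarge P i r) j (r\<inverse>)"
    have ij: "i \<notin> voters P" "j \<notin> voters P"
      using i j less.prems(4) by auto
    have Q: "is_profile Q"
      unfolding Q_def using less.prems(3) r
      by (intro is_profile_enlarge) (auto intro: lin_order_converse)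
    have rev: "add_reversal P Q"
      unfolding add_reversal_def
      using less.prems(3) Q ij j(2) r unfolding Q_def
      by (intro conjI exI[of _ i] exI[of _ j] exI[of _ r]) auto
    have "{i, j} \<subseteq> D" "card {i, j} = 2"
      using i j by auto
    then have card: "card D = card (D - {i, j}) + 2"
      using less.prems(1) card_mono[of D "{i, j}"] card_Diff_subset[of "{i, j}" D] by simp
    have "\<exists>R. is_profile R \<and> voters R = voters Q \<union> (D - {i, j}) \<and> cands R = cands Q
      \<and> (\<forall>a b. margin R a b = margin Q a b) \<and> f R = f Q"
      using less.prems Q card by (intro less.hyps) (auto simp: Q_def)
    moreover have "voters Q \<union> (D - {i, j}) = voters P \<union> D" "cands Q = cands P"
      using i j by (auto simp: Q_def)
    moreover have "f Q = f P"
      using nrev rev unfolding neutral_reversal_def by blast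
    ultimately show ?thesis
      using margin_add_reversal[OF rev] by metis
  qed
qed

text \<open>Two profiles with the same voters and the same margin of \<open>x\<close> over \<open>y\<close> have equally many
supporters of \<open>x\<close> against \<open>y\<close>, so a permutation of the voters makes their restrictions to
\<open>x, y\<close> equal.\<close>
lemma defeat_transfer_same_voters:
  assumes P: "is_profile P" and Q: "is_profile Q" and V: "voters Q = voters P"
    and sub: "cands Q \<subseteq> cands P" and xy: "x \<in> cands Q" "y \<in> cands Q" "x \<noteq> y"
    and eq: "margin Q x y = margin P x y"
    and le: "\<And>a b. a \<in> cands Q \<Longrightarrow> b \<in> cands Q \<Longrightarrow> {a, b} \<noteq> {x, y} \<Longrightarrow> margin Q a b > 0
      \<Longrightarrow> margin Q a b \<le> margin P a b"
    and def: "(x, y) \<in> f P"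
  shows "(x, y) \<in> f Q"
proof -
  define A where "A = {i \<in> voters P. (x, y) \<in> ballot P i}"
  define B where "B = {i \<in> voters P. (x, y) \<in> ballot Q i}"
  have fin: "finite (voters P)" using P by (rule profile_finite)
  have "card A = card B"
    using card_supporters[OF P _ _ xy(3)] card_supporters[OF Q xy] xy(1,2) sub eq V
    by (simp add: A_def B_def subset_iff)
  moreover have AB: "A \<subseteq> voters P" "B \<subseteq> voters P"
    by (auto simp: A_def B_def)
  ultimately have "card (voters P - A) = card (voters P - B)"
    using fin by (simp add: card_Diff_subset finite_subset)
  then obtain h k where h: "bij_betw h A B" and k: "bij_betw k (voters P - A) (voters P - B)"
    using \<open>card A = card B\<close> AB fin
    by (meson finite_Diff finite_same_card_bij finite_subset)
  \<comment> \<open>Supporters and opponents of \<open>x\<close> are matched separately between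
    \<open>P\<close> and \<open>Q\<close>; the two matchings are glued to a permutation of the
    voters.\<close>
  define \<pi> where "\<pi> i = (if i \<in> A then h i else k i)" for i
  have "bij_betw \<pi> A B"
    using h by (rule iffD1[OF bij_betw_cong, rotated]) (simp add: \<pi>_def)
  moreover have "bij_betw \<pi> (voters P - A) (voters P - B)"
    using k by (rule iffD1[OF bij_betw_cong, rotated]) (simp add: \<pi>_def)
  ultimately have "bij_betw \<pi> (A \<union> (voters P - A)) (B \<union> (voters P - B))"
    by (rule bij_betw_combine) auto
  then have \<pi>: "bij_betw \<pi> (voters P) (voters P)"
    using AB by (simp add: Un_absorb1)
  then have \<pi>_in: "\<pi> i \<in> voters P" if "i \<in> voters P" for i
    using that by (auto simp: bij_betw_def)
  have \<pi>_iff: "\<pi> i \<in> B \<longleftrightarrow> i \<in> A" if "i \<in> voters P" for i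
    using that h k AB by (auto simp: \<pi>_def bij_betw_def)
  \<comment> \<open>\<open>R\<close> deals out the ballots of \<open>Q\<close> anew, so that exactly
    those who rank \<open>x\<close> above \<open>y\<close> in \<open>P\<close> do so in
    \<open>R\<close>.\<close>
  define R where "R = \<lparr>voters = voters P, cands = cands Q,
    ballot = (\<lambda>i. if i \<in> voters P then ballot Q (\<pi> i) else {})\<rparr>"
  have R: "is_profile R"
    using Q V \<pi>_in P unfolding R_def is_profile_def by auto
  have marg: "margin R a b = margin Q a b" for a b
    by (rule margin_permute[where \<pi> = \<pi>]) (use fin V \<pi> in \<open>auto simp: R_def\<close>)
  have "ballot P i \<inter> {x, y} \<times> {x, y} = ballot R i \<inter> {x, y} \<times> {x, y}" for i
  proof (cases "i \<in> voters P")
    case True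
    have lp: "lin_order (cands P) (ballot P i)" and lr: "lin_order (cands Q) (ballot R i)"
      using True P R profile_lin_order[of P i] profile_lin_order[of R i] by (auto simp: R_def)
    have "(x, y) \<in> ballot P i \<longleftrightarrow> (x, y) \<in> ballot R i"
      using \<pi>_iff[OF True] \<pi>_in[OF True] True by (auto simp: A_def B_def R_def)
    moreover have "(y, x) \<in> ballot P i \<longleftrightarrow> (x, y) \<notin> ballot P i"
      using lin_order_total[OF lp, of x y] lin_order_asym[OF lp] xy sub by blast
    moreover have "(y, x) \<in> ballot R i \<longleftrightarrow> (x, y) \<notin> ballot R i"
      using lin_order_total[OF lr, of x y] lin_order_asym[OF lr] xy by blast
    ultimately show ?thesis
      using lin_order_irrefl[OF lp] lin_order_irrefl[OF lr] by auto
  next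
    case False
    then show ?thesis using P by (simp add: is_profile_def R_def)
  qed
  then have "restrict P {x, y} = restrict R {x, y}"
    by (simp add: restrict_def R_def)
  moreover have "cands R = cands Q" by (simp add: R_def)
  moreover have "margin P a b > 0 \<and> margin R a b \<le> margin P a b"
    if "a \<in> cands Q" "b \<in> cands Q" "{a, b} \<noteq> {x, y}" "margin R a b > 0" for a b
    using le[of a b] that marg[of a b] by simp
  ultimately have "ciia_step P x y R"
    unfolding ciia_step_def using P R xy sub eq marg by simp
  then have "(x, y) \<in> f R"
    using ciia def unfolding coherent_IIA_def by blast
  moreover have "f Q = f R"
    using anon[unfolded anonymity_def, rule_format, of Q R \<pi>] Q R V \<pi> by (simp add: R_def)
  ultimately show ?thesis by simp
qed

text \<open>Equal margins of \<open>x\<close> over \<open>y\<close> force electorates of equal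
  parity. Reversal pairs then extend both to a common voter set without affecting margins or
  defeats, which reduces everything to the case of the same voters.\<close>

lemma defeat_transfer:
  assumes P: "is_profile P" and Q: "is_profile Q"
    and sub: "cands Q \<subseteq> cands P" and xy: "x \<in> cands Q" "y \<in> cands Q" "x \<noteq> y"
    and eq: "margin Q x y = margin P x y"
    and le: "\<And>a b. a \<in> cands Q \<Longrightarrow> b \<in> cands Q \<Longrightarrow> {a, b} \<noteq> {x, y} \<Longrightarrow> margin Q a b > 0
      \<Longrightarrow> margin Q a b \<le> margin P a b"
    and def: "(x, y) \<in> f P"
  shows "(x, y) \<in> f Q"
proof -
  have fin: "finite (voters P)" "finite (voters Q)"
    using P Q profile_finite by auto
  have par: "even (card (voters P)) \<longleftrightarrow> even (card (voters Q))"
  proof -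
    have "x \<in> cands P" "y \<in> cands P" using xy sub by auto
    then show ?thesis
      using card_supporters[OF P _ _ xy(3)] card_supporters[OF Q xy] eq
      by (metis even_add even_of_nat dvd_triv_left)
  qed
  \<comment> \<open>One fresh voter joins the union when its size has the wrong parity.\<close>
  have "\<exists>W. finite W \<and> voters P \<subseteq> W \<and> voters Q \<subseteq> W \<and> even (card W - card (voters P))"
  proof (cases "even (card (voters P \<union> voters Q) - card (voters P))")
    case True
    then show ?thesis using fin by (intro exI[of _ "voters P \<union> voters Q"]) auto
  next
    case False
    obtain i where "i \<notin> voters P \<union> voters Q"
      by (rule infinite_UNIV_fresh[OF inf, of "voters P \<union> voters Q"]) (use fin in auto)
    then show ?thesis
      using fin False card_mono[of "voters P \<union> voters Q" "voters P"]
      by (intro exI[of _ "insert i (voters P \<union> voters Q)"]) (auto simp: Suc_diff_le)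
  qed
  then obtain W where W: "finite W" "voters P \<subseteq> W" "voters Q \<subseteq> W"
    "even (card W - card (voters P))"
    by blast
  then have "even (card W - card (voters Q))"
    using par card_mono[of W "voters P"] card_mono[of W "voters Q"] by auto
  then have ev: "even (card (W - voters P))" "even (card (W - voters Q))"
    using W fin by (simp_all add: card_Diff_subset)
  have disj: "(W - voters P) \<inter> voters P = {}" "(W - voters Q) \<inter> voters Q = {}"
    and un: "voters P \<union> (W - voters P) = W" "voters Q \<union> (W - voters Q) = W"
    using W(2,3) by auto
  obtain P' where P': "is_profile P'" "voters P' = W" "cands P' = cands P"
    "\<forall>a b. margin P' a b = margin P a b" "f P' = f P"
    using ex_extend_voters[OF _ ev(1) P disj(1)] W(1) unfolding un by blast
  obtain Q' where Q': "is_profile Q'" "voters Q' = W" "cands Q' = cands Q"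
    "\<forall>a b. margin Q' a b = margin Q a b" "f Q' = f Q"
    using ex_extend_voters[OF _ ev(2) Q disj(2)] W(1) unfolding un by blast
  have "(x, y) \<in> f Q'"
    by (rule defeat_transfer_same_voters[OF P'(1) Q'(1)]) (use P' Q' sub xy eq le def in auto)
  then show ?thesis using Q'(5) by simp
qed

section \<open>Defeat requires a positive margin\<close>

lemma defeat_rename:
  assumes P: "is_profile P" and \<pi>: "bij_betw \<pi> (cands P) (cands P)" and def: "(x, y) \<in> f P"
  shows "(\<pi> x, \<pi> y) \<in> f (rename \<pi> P)"
proof -
  have inj: "inj_on \<pi> (cands P)" using \<pi> by (simp add: bij_betw_def)
  have xy: "x \<in> cands P" "y \<in> cands P" using defeat_in_cands[OF P def] by auto
  have "voters (rename \<pi> P) = voters P" "cands (rename \<pi> P) = cands P"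
    using \<pi> by (auto simp: rename_def bij_betw_def)
  moreover have "\<forall>i\<in>voters P. \<forall>x\<in>cands P. \<forall>y\<in>cands P.
      (x, y) \<in> ballot P i \<longleftrightarrow> (\<pi> x, \<pi> y) \<in> ballot (rename \<pi> P) i"
    using in_rename_ballot_iff[OF P inj] by blast
  ultimately show ?thesis
    using neut P is_profile_rename[OF P inj] \<pi> xy def unfolding neutrality_def by blast
qed

lemma margin_rename':
  assumes "is_profile P" "inj_on \<pi> (cands P)" "a \<in> cands P" "b \<in> cands P"
  shows "margin (rename \<pi> P) (\<pi> a) (\<pi> b) = margin P a b"
  by (rule margin_rename)
    (use assms in \<open>auto simp: in_rename_ballot_iff profile_finite\<close>)

text \<open>With two candidates, turning one ballot around moves \<open>x\<close> up one place and
  raises its margin by 2. The bound by the number of voters guarantees a ballot to turn as long as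
  the margin is below \<open>m\<close>.\<close>

lemma ex_two_candidate_margin:
  assumes "is_profile P" "cands P = {x, y}" "x \<noteq> y" "(x, y) \<in> f P"
    "margin P x y \<le> m" "even (m - margin P x y)" "m \<le> int (card (voters P))"
  shows "\<exists>Q. is_profile Q \<and> cands Q = {x, y} \<and> margin Q x y = m \<and> (x, y) \<in> f Q"
  using assms
proof (induction "nat (m - margin P x y)" arbitrary: P rule: less_induct)
  case (less P)
  note P = less.prems(1) and C = less.prems(2)
  have fin: "finite (voters P)" using P by (rule profile_finite)
  show ?case
  proof (cases "margin P x y = m")
    case True
    then show ?thesis using less.prems by blast
  next
    case False
    then have lt: "margin P x y < m" using less.prems(5) by simp
    have "{i \<in> voters P. (x, y) \<in> ballot P i} \<noteq> voters P"
    proof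
      assume "{i \<in> voters P. (x, y) \<in> ballot P i} = voters P"
      then show False
        using card_supporters[OF P _ _ \<open>x \<noteq> y\<close>] C lt less.prems(7) by simp
    qed
    then obtain i where i: "i \<in> voters P" "(x, y) \<notin> ballot P i" by blast
    have lin: "lin_order {x, y} (ballot P i)"
      using profile_lin_order[OF P i(1)] C by simp
    then have "(y, x) \<in> ballot P i"
      using lin_order_total[OF lin, of x y] i(2) \<open>x \<noteq> y\<close> by simp
    then have bal: "ballot P i = {(y, x)}"
      using lin_order_subset[OF lin] lin_order_irrefl[OF lin] i(2) by auto
    define Q where "Q = P\<lparr>ballot := (ballot P)(i := {(x, y)})\<rparr>"
    have "lin_order {x, y} {(x, y)}"
      using \<open>x \<noteq> y\<close> by (intro lin_orderI) auto
    then have Q: "is_profile Q" "cands Q = {x, y}" "voters Q = voters P"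
      using P C i(1) by (auto simp: Q_def is_profile_def)
    have "one_up P Q x"
      unfolding one_up_def using P Q C i(1) bal \<open>x \<noteq> y\<close>
      by (auto simp: Q_def intro!: bexI[of _ i] exI[of _ y])
    moreover have "card (cands P) = 2" using C \<open>x \<noteq> y\<close> by simp
    ultimately have def: "(x, y) \<in> f Q"
      using mono2 less.prems(4) unfolding monotonicity_two_def by blast
    have "margin Q x y = net {(x, y)} x y + (\<Sum>j\<in>voters P - {i}. net (ballot P j) x y)"
      using fin i(1) by (simp add: margin_eq_sum Q_def sum.remove)
    moreover have "margin P x y = net {(y, x)} x y + (\<Sum>j\<in>voters P - {i}. net (ballot P j) x y)"
      using fin i(1) bal by (simp add: margin_eq_sum sum.remove)
    ultimately have marg: "margin Q x y = margin P x y + 2"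
      using \<open>x \<noteq> y\<close> by (simp add: net_def)
    \<comment> \<open>Equal parity rules out stepping over \<open>m\<close>.\<close>
    have "margin P x y + 2 \<le> m"
      using lt less.prems(6) by presburger
    then show ?thesis
      using less.hyps[of Q] Q def marg less.prems(3,6,7) by simp
  qed
qed

lemma defeat_irrefl: "is_profile P \<Longrightarrow> (x, y) \<in> f P \<Longrightarrow> x \<noteq> y"
  using defeat_asym by blast

text \<open>Exchanging \<open>x\<close> and \<open>y\<close> turns a defeat against the majority into one whose winner can be
given, by monotonicity, the margin of the loser.\<close>
lemma defeat_imp_margin_pos:
  assumes P: "is_profile P" and def: "(x, y) \<in> f P"
  shows "margin P x y > 0"
proof (rule ccontr)
  assume nonpos: "\<not> margin P x y > 0"
  have xy: "x \<in> cands P" "y \<in> cands P" "x \<noteq> y"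
    using defeat_in_cands[OF P def] defeat_irrefl[OF P def] by auto
  define P2 where "P2 = restrict P {x, y}"
  have P2: "is_profile P2" "cands P2 = {x, y}" "margin P2 x y = margin P x y"
    using is_profile_restrict[OF P, of "{x, y}"] xy margin_restrict[of x "{x, y}" y P]
    by (auto simp: P2_def restrict_def)
  \<comment> \<open>With only \<open>x\<close> and \<open>y\<close> around, the remaining pairs are
    diagonal with margin 0, so the weight condition of a transfer holds vacuously.\<close>
  have trivial: "margin Q a b \<le> 0" if "a \<in> {x, y}" "b \<in> {x, y}" "{a, b} \<noteq> {x, y}"
    for Q :: "('v, 'c) profile" and a b
    using that by auto
  have def2: "(x, y) \<in> f P2"
    using trivial by (intro defeat_transfer[OF P P2(1) _ _ _ xy(3) P2(3) _ def])
      (use P2(2) xy in \<open>auto dest: leD\<close>)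
  define \<pi> where "\<pi> = id(x := y, y := x)"
  have \<pi>: "bij_betw \<pi> (cands P2) (cands P2)" "\<pi> x = y" "\<pi> y = x"
    using xy(3) P2(2) by (auto simp: \<pi>_def bij_betw_def inj_on_def)
  define R where "R = rename \<pi> P2"
  have inj: "inj_on \<pi> (cands P2)" and "cands R = {x, y}"
    using \<pi> P2(2) by (auto simp: bij_betw_def R_def)
  have R: "is_profile R" "(y, x) \<in> f R" "margin R y x = margin P x y"
    using is_profile_rename[OF P2(1) inj] defeat_rename[OF P2(1) \<pi>(1) def2]
      margin_rename'[OF P2(1) inj, of x y] \<pi>(2,3) P2(2,3) by (auto simp: R_def)
  \<comment> \<open>The margin aimed at, \<open>- margin P x y\<close>, must not exceed the number
    of voters; it does not, since at most all of them rank \<open>y\<close> above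
    \<open>x\<close>.\<close>
  have "2 * int (card {i \<in> voters P2. (y, x) \<in> ballot P2 i}) = int (card (voters P2)) - margin P x y"
    using card_supporters[OF P2(1), of y x] P2(2,3) xy(3) margin_swap[of P2 x y] by simp
  moreover have "card {i \<in> voters P2. (y, x) \<in> ballot P2 i} \<le> card (voters P2)"
    using profile_finite[OF P2(1)] by (intro card_mono) auto
  ultimately have "- margin P x y \<le> int (card (voters P2))"
    by linarith
  then obtain Q where Q: "is_profile Q" "cands Q = {x, y}" "margin Q x y = - margin P x y" "(x, y) \<in> f Q"
    using ex_two_candidate_margin[OF P2(1,2) xy(3) def2, of "- margin P x y"] P2(3) nonpos by auto
  \<comment> \<open>\<open>Q\<close> gives \<open>y\<close> over \<open>x\<close> the same margin as
    \<open>R\<close>, so the defeat of \<open>x\<close> by \<open>y\<close> carries over and clashes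
    with that of \<open>y\<close> by \<open>x\<close>.\<close>
  have "(y, x) \<in> f Q"
  proof (rule defeat_transfer[OF R(1) Q(1) _ _ _ _ _ _ R(2)])
    show "margin Q y x = margin R y x"
      using Q(3) R(3) margin_swap[of Q x y] by simp
    show "margin Q a b \<le> margin R a b"
      if "a \<in> cands Q" "b \<in> cands Q" "{a, b} \<noteq> {y, x}" "margin Q a b > 0" for a b
      using trivial[of a b Q] that Q(2) by (auto simp: insert_commute)
  qed (use Q(2) \<open>cands R = {x, y}\<close> xy(3) in auto)
  then show False using defeat_asym[OF Q(1,4)] by simp
qed

text \<open>Doubling makes the margins even, so that a profile exists whose margin graph is exactly the
cycle with all edges of weight \<open>2 m\<close>; there, by symmetry, every candidate is defeated by its
predecessor.\<close>
lemma no_cycle: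
  assumes P: "is_profile P" and C: "C \<subseteq> cands P" and s: "bij_betw s C C"
    and x: "x \<in> C" and orbit: "\<And>c. c \<in> C \<Longrightarrow> \<exists>k. c = (s ^^ k) x"
    and ge: "\<And>a. a \<in> C \<Longrightarrow> margin P x (s x) \<le> margin P a (s a)"
    and def: "(x, s x) \<in> f P"
  shows False
proof -
  define m where "m = margin P x (s x)"
  have "m > 0" using defeat_imp_margin_pos[OF P def] by (simp add: m_def)
  have sC: "s c \<in> C" if "c \<in> C" for c using that s by (auto simp: bij_betw_def)
  have s_inj: "s a = s b \<longleftrightarrow> a = b" if "a \<in> C" "b \<in> C" for a b
    using that s by (auto simp: bij_betw_def dest: inj_onD)
  \<comment> \<open>All margins along the cycle are positive, so two consecutive edges cannot
    reverse each other and the cycle has at least three candidates.\<close>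
  have no_two: "s (s a) \<noteq> a" "s a \<noteq> a" if "a \<in> C" for a
    using ge[OF that] ge[OF sC[OF that]] \<open>m > 0\<close> margin_swap[of P a "s a"] by (auto simp: m_def)
  \<comment> \<open>Weight \<open>2 * m\<close> from each \<open>a\<close> to \<open>s a\<close> and
    its negative backwards; the factor 2 makes the weights even and matches the doubled
    profile.\<close>
  define w where "w a b = 2 * m * (of_bool (b = s a) - of_bool (a = s b))" for a b
  have finC: "finite C" using P C by (auto simp: is_profile_def intro: finite_subset)
  obtain Q :: "('v, 'c) profile" where Q: "is_profile Q" "cands Q = C"
    and margQ: "\<And>a b. a \<in> C \<Longrightarrow> b \<in> C \<Longrightarrow> margin Q a b = w a b"
  proof -
    have "C \<noteq> {}" "w b a = - w a b" "even (w a b)" for a b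
      using x by (auto simp: w_def algebra_simps)
    then show ?thesis
      using ex_profile_margins[OF inf finC, of w] that by blast
  qed
  obtain P2 where dbl: "doubling P P2" using ex_doubling[OF inf P] by blast
  have P2: "is_profile P2" "cands P2 = cands P"
    using dbl by (auto simp: doubling_def)
  have def2: "(x, s x) \<in> f P2"
    using uphom dbl def unfolding upward_homogeneity_def by blast
  have start: "(x, s x) \<in> f Q"
  proof (rule defeat_transfer[OF P2(1) Q(1) _ _ _ _ _ _ def2])
    show "margin Q x (s x) = margin P2 x (s x)"
      using margQ[OF x sC[OF x]] no_two(1)[OF x] by (simp add: margin_doubling[OF dbl] w_def m_def)
    show "margin Q a b \<le> margin P2 a b"
      if "a \<in> cands Q" "b \<in> cands Q" "{a, b} \<noteq> {x, s x}" "margin Q a b > 0" for a b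
    proof -
      have ab: "a \<in> C" "b \<in> C" using that(1,2) Q(2) by auto
      have pos: "w a b > 0" using that(4) margQ[OF ab] by simp
      have sa: "b = s a"
      proof (rule ccontr)
        assume "b \<noteq> s a"
        then have "w a b \<le> 0"
          using \<open>m > 0\<close> by (simp add: w_def)
        then show False using pos by simp
      qed
      then have "w a b = 2 * m"
        using no_two(1)[OF ab(1)] by (simp add: w_def)
      with sa show ?thesis
        using ge[OF ab(1)] margQ[OF ab] by (simp add: margin_doubling[OF dbl] m_def)
    qed
  qed (use Q(2) P2(2) C x sC no_two(2)[OF x] in auto)
  have inj: "inj_on s (cands Q)" using s Q(2) by (simp add: bij_betw_def)
  \<comment> \<open>\<open>s\<close> is a symmetry of the margins of \<open>Q\<close>, so renaming
    along it and transferring back moves the defeat one step along the cycle.\<close>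
  have rotate: "(s u, s (s u)) \<in> f Q" if "u \<in> C" "(u, s u) \<in> f Q" for u
  proof (rule defeat_transfer[OF is_profile_rename[OF Q(1) inj] Q(1)])
    show "(s u, s (s u)) \<in> f (rename s Q)"
      using defeat_rename[OF Q(1) _ that(2)] s Q(2) by simp
    have eq: "margin (rename s Q) a b = margin Q a b" if ab: "a \<in> C" "b \<in> C" for a b
    proof -
      have "a \<in> s ` C" "b \<in> s ` C"
        using ab s by (auto simp: bij_betw_def)
      then obtain a' b' where ab': "a' \<in> C" "a = s a'" "b' \<in> C" "b = s b'"
        by blast
      have "margin (rename s Q) a b = w a' b'"
        using margin_rename'[OF Q(1) inj, of a' b'] ab' Q(2) margQ by simp
      also have "\<dots> = w a b"
        using ab' s_inj sC by (simp add: w_def)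
      finally show ?thesis using margQ[OF ab] by simp
    qed
    show "margin Q (s u) (s (s u)) = margin (rename s Q) (s u) (s (s u))"
      using eq that(1) sC by simp
    show "margin Q a b \<le> margin (rename s Q) a b" if "a \<in> cands Q" "b \<in> cands Q" for a b
      using eq that Q(2) by simp
  qed (use Q(2) s that(1) sC no_two(2)[OF sC[OF that(1)]] in \<open>auto simp: bij_betw_def\<close>)
  have all: "(s ^^ k) x \<in> C \<and> ((s ^^ k) x, s ((s ^^ k) x)) \<in> f Q" for k
  proof (induction k)
    case 0
    then show ?case using x start by simp
  next
    case (Suc k)
    then show ?case using rotate sC by simp
  qed
  obtain z where z: "z \<in> C" "\<And>u. (u, z) \<notin> f Q"
    using avail Q unfolding availability_def by blast
  have "z \<in> s ` C" using z(1) s by (simp add: bij_betw_def)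
  then obtain d where d: "d \<in> C" "z = s d" by blast
  then show False
    using orbit[OF d(1)] all z(2) by auto
qed

text \<open>A simple path from \<open>y\<close> to \<open>x\<close> of strength at least the margin
  would close up, with the edge from \<open>x\<close> to \<open>y\<close> as one of minimal weight,
  to a cycle of the kind excluded by \<open>no_cycle\<close>.\<close>

lemma defeat_subset_sc:
  assumes P: "is_profile P"
  shows "f P \<subseteq> sc P"
proof (rule subrelI)
  fix x y assume def: "(x, y) \<in> f P"
  define m where "m = margin P x y"
  have "m > 0" using defeat_imp_margin_pos[OF P def] by (simp add: m_def)
  have "(y, x) \<notin> (strong P m)\<^sup>+"
  proof
    assume "(y, x) \<in> (strong P m)\<^sup>+"
    then obtain n z where z: "z 0 = y" "z n = x" "inj_on z {..n}"
      "\<And>i. i < n \<Longrightarrow> margin P (z i) (z (Suc i)) \<ge> m"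
      using rtrancl_imp_simple_path[OF trancl_into_rtrancl, of y x "strong P m"] by auto
    define C where "C = z ` {..n}"
    \<comment> \<open>The successor map of the cycle: the last vertex \<open>z n\<close>, which is
      \<open>x\<close>, is sent back to \<open>y\<close>.\<close>
    define s where "s c = (let i = the_inv_into {..n} z c in if i = n then y else z (Suc i))" for c
    have s_step: "s (z i) = z (Suc i)" if "i < n" for i
      using that z(3) by (simp add: s_def the_inv_into_f_f)
    have s_x: "s x = y"
      using the_inv_into_f_f[OF z(3), of n] z(2) by (simp add: s_def)
    have "s ` C = C"
    proof
      show "s ` C \<subseteq> C"
      proof
        fix c assume "c \<in> s ` C"
        then obtain i where i: "i \<le> n" "c = s (z i)" by (auto simp: C_def)
        then show "c \<in> C"
          using s_step[of i] s_x z(1,2)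
          by (cases "i = n") (auto simp: C_def intro: rev_image_eqI[of 0])
      qed
      show "C \<subseteq> s ` C"
      proof
        fix c assume "c \<in> C"
        then obtain i where i: "i \<le> n" "c = z i" by (auto simp: C_def)
        show "c \<in> s ` C"
        proof (cases i)
          case 0
          then have "c = s (z n)" using i z(1,2) s_x by simp
          then show ?thesis by (auto simp: C_def)
        next
          case (Suc j)
          then have "c = s (z j)" using i s_step[of j] by simp
          then show ?thesis using Suc i(1) by (auto simp: C_def)
        qed
      qed
    qed
    then have s: "bij_betw s C C"
      by (simp add: bij_betw_def C_def finite_surj_inj eq_card_imp_inj_on)
    \<comment> \<open>The shift by one arises because the path begins at \<open>y\<close>, which is
      \<open>s x\<close>.\<close>
    have orbit: "z i = (s ^^ Suc i) x" if "i \<le> n" for i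
      using that by (induction i) (auto simp: s_x z(1) s_step[symmetric])
    show False
    proof (rule no_cycle[OF P _ s])
      show "C \<subseteq> cands P"
      proof
        fix c assume "c \<in> C"
        then obtain i where i: "i \<le> n" "c = z i" by (auto simp: C_def)
        show "c \<in> cands P"
        proof (cases "i = n")
          case True
          then show ?thesis using i z(2) defeat_in_cands[OF P def] by simp
        next
          case False
          then show ?thesis
            using i z(4)[of i] \<open>m > 0\<close> margin_pos_in_cands(1)[OF P, of "z i" "z (Suc i)"] by simp
        qed
      qed
      show "x \<in> C" using z(2) by (auto simp: C_def)
      show "\<exists>k. c = (s ^^ k) x" if "c \<in> C" for c
        using that orbit by (auto simp: C_def simp del: funpow.simps)
      show "margin P x (s x) \<le> margin P a (s a)" if aC: "a \<in> C" for a
      proof -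
        obtain i where i: "i \<le> n" "a = z i" using aC by (auto simp: C_def)
        then show ?thesis
          using z(2) z(4)[of i] s_step[of i] s_x by (cases "i = n") (auto simp: m_def)
      qed
      show "(x, s x) \<in> f P" using def s_x by simp
    qed
  qed
  then show "(x, y) \<in> sc P"
    using \<open>m > 0\<close> by (simp add: sc_iff m_def)
qed

text \<open>Positive Involvement in Defeat, read contrapositively and iterated: a defeat of
  \<open>y\<close> by \<open>x\<close> present after adding \<open>k\<close> voters with the ballot
  \<open>r\<close> was present before.\<close>

lemma ex_add_opponents:
  assumes "is_profile P" "lin_order (cands P) r" "(y, x) \<in> r"
  shows "\<exists>Q. is_profile Q \<and> cands Q = cands P
    \<and> (\<forall>a b. margin Q a b = margin P a b + int k * net r a b)
    \<and> ((x, y) \<in> f Q \<longrightarrow> (x, y) \<in> f P)"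
proof (induction k)
  case 0
  show ?case using assms(1) by (intro exI[of _ P]) simp
next
  case (Suc k)
  then obtain Q where Q: "is_profile Q" "cands Q = cands P"
    "\<forall>a b. margin Q a b = margin P a b + int k * net r a b"
    "(x, y) \<in> f Q \<longrightarrow> (x, y) \<in> f P"
    by blast
  obtain i where i: "i \<notin> voters Q"
    by (rule infinite_UNIV_fresh[OF inf profile_finite[OF Q(1)]])
  have R: "is_profile (enlarge Q i r)"
    using Q(1,2) assms(2) by (simp add: is_profile_enlarge)
  then have "add_voter Q i r (enlarge Q i r)"
    using Q(1,2) i assms(2) by (simp add: add_voter_def)
  then have "(x, y) \<in> f (enlarge Q i r) \<longrightarrow> (x, y) \<in> f Q"
    using pid assms(3) unfolding positive_involvement_defeat_def by blast
  moreover have "margin (enlarge Q i r) a b = margin P a b + int (Suc k) * net r a b" for a b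
    using margin_enlarge[OF Q(1) i, of r a b] Q(3) by (simp add: algebra_simps)
  ultimately show ?case
    using R Q(2,4) by (intro exI[of _ "enlarge Q i r"]) auto
qed

text \<open>Let \<open>T\<close> consist of the candidates reachable from \<open>y\<close> along edges of weight at least
\<open>m\<close>, the margin of \<open>x\<close> over \<open>y\<close>. Adding \<open>m - 1\<close> voters who rank everything outside
\<open>T\<close> above everything inside \<open>T\<close>, except for putting \<open>y\<close> directly above \<open>x\<close>, removes
every edge leaving \<open>T\<close> and keeps the edge from \<open>x\<close> to \<open>y\<close>.\<close>
lemma sc_subset_defeat:
  assumes P: "is_profile P"
  shows "sc P \<subseteq> f P"
proof (rule subrelI)
  fix x y assume xy: "(x, y) \<in> sc P"
  define m where "m = margin P x y"
  have m: "m > 0" and nopath: "(y, x) \<notin> (strong P m)\<^sup>+"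
    using xy by (auto simp: sc_iff m_def)
  have "x \<noteq> y" using m by (auto simp: m_def)
  have cxy: "x \<in> cands P" "y \<in> cands P"
    using margin_pos_in_cands[OF P] m by (auto simp: m_def)
  define T where "T = {t \<in> cands P. (y, t) \<in> (strong P m)\<^sup>*}"
  have yT: "y \<in> T" using cxy by (simp add: T_def)
  have xT: "x \<notin> T" using nopath \<open>x \<noteq> y\<close> by (auto simp: T_def rtrancl_eq_or_trancl)
  define Y where "Y = cands P - T - {x}"
  have "finite Y" "finite (T - {y})"
    using P by (auto simp: Y_def T_def is_profile_def)
  then obtain rY rT where rY: "lin_order Y rY" and rT: "lin_order (T - {y}) rT"
    using ex_lin_order by blast
  \<comment> \<open>From top to bottom: \<open>Y\<close>, then \<open>y\<close>, \<open>x\<close>,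
    and the rest of \<open>T\<close>.\<close>
  define r where "r = rY \<union> ({(y, x)} \<union> rT \<union> {y, x} \<times> (T - {y})) \<union> Y \<times> ({y, x} \<union> (T - {y}))"
  have "lin_order {y, x} {(y, x)}"
    using \<open>x \<noteq> y\<close> by (intro lin_orderI) auto
  then have "lin_order ({y, x} \<union> (T - {y})) ({(y, x)} \<union> rT \<union> {y, x} \<times> (T - {y}))"
    using rT xT by (intro lin_order_append) auto
  then have "lin_order (Y \<union> ({y, x} \<union> (T - {y}))) r"
    unfolding r_def by (rule lin_order_append[OF rY]) (use yT in \<open>auto simp: Y_def\<close>)
  moreover have "Y \<union> ({y, x} \<union> (T - {y})) = cands P"
    using cxy by (auto simp: Y_def T_def)
  ultimately have r: "lin_order (cands P) r" by simp
  have yx: "(y, x) \<in> r" by (simp add: r_def)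
  obtain Q where Q: "is_profile Q" "cands Q = cands P"
    "\<And>a b. margin Q a b = margin P a b + int (nat (m - 1)) * net r a b"
    "(x, y) \<in> f Q \<longrightarrow> (x, y) \<in> f P"
    using ex_add_opponents[OF P r yx] by metis
  have "(x, y) \<notin> r" using lin_order_asym[OF r yx] .
  \<comment> \<open>The \<open>m - 1\<close> opponents bring this margin down from \<open>m\<close>
    to 1, the least value to which Coherent Defeat applies.\<close>
  then have one: "margin Q x y = 1"
    using Q(3)[of x y] yx m by (simp add: net_def m_def)
  \<comment> \<open>An edge leaving \<open>T\<close> had margin below \<open>m\<close> in
    \<open>P\<close>, as otherwise its head would lie in \<open>T\<close>; losing
    \<open>m - 1\<close> makes it nonpositive. The exceptional pair from \<open>y\<close> to
    \<open>x\<close> has margin -1 in \<open>Q\<close>.\<close>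
  have stay: "u \<in> T" if t: "t \<in> T" and tu: "(t, u) \<in> strong Q 1" for t u
  proof (rule ccontr)
    assume u: "u \<notin> T"
    have uC: "u \<in> cands P"
      using margin_pos_in_cands(2)[OF Q(1), of t u] tu Q(2) by simp
    have "margin P t u < m"
    proof (rule ccontr)
      assume "\<not> margin P t u < m"
      then have "(y, u) \<in> (strong P m)\<^sup>*"
        using t by (auto simp: T_def intro: rtrancl.rtrancl_into_rtrancl)
      then show False using u uC by (simp add: T_def)
    qed
    moreover have "\<not> (t = y \<and> u = x)"
      using one tu margin_swap[of Q x y] by auto
    then have "(u, t) \<in> r"
      using t u uC yT by (auto simp: r_def Y_def)
    then have "net r t u = -1"
      using lin_order_asym[OF r] by (simp add: net_def)
    ultimately show False
      using Q(3)[of t u] tu m by simp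
  qed
  have "\<not> (\<exists>xs. majority_path Q xs \<and> hd xs = y \<and> last xs = x)"
  proof
    assume "\<exists>xs. majority_path Q xs \<and> hd xs = y \<and> last xs = x"
    then have "(y, x) \<in> (strong Q 1)\<^sup>+"
      using path_imp_trancl[of _ "strong Q 1"] by (fastforce simp: majority_path_def)
    then have "x \<in> T"
      by (induction rule: trancl_induct) (use stay yT in blast)+
    then show False using xT by simp
  qed
  then have "(x, y) \<in> f Q"
    using cdef Q(1) one unfolding coherent_defeat_def by (metis zero_less_one)
  then show "(x, y) \<in> f P" using Q(4) by simp
qed

end

theorem theorem4p1:
  assumes "infinite (UNIV :: 'v set)" and "infinite (UNIV :: 'c set)"
  shows "(vccr (sc :: ('v, 'c) profile \<Rightarrow> ('c \<times> 'c) set) \<and> anonymity sc \<and> neutrality sc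
          \<and> availability sc \<and> homogeneity sc \<and> monotonicity sc \<and> neutral_reversal sc
          \<and> coherent_IIA sc \<and> coherent_defeat sc \<and> positive_involvement_defeat sc)
       \<and> (\<forall>f :: ('v, 'c) profile \<Rightarrow> ('c \<times> 'c) set.
            vccr f \<and> anonymity f \<and> neutrality f \<and> availability f \<and> upward_homogeneity f
            \<and> monotonicity_two f \<and> neutral_reversal f \<and> coherent_IIA f \<and> coherent_defeat f
            \<and> positive_involvement_defeat f
            \<longrightarrow> (\<forall>P. is_profile P \<longrightarrow> f P = sc P))"
proof (intro conjI allI impI)
  fix f :: "('v, 'c) profile \<Rightarrow> ('c \<times> 'c) set" and P :: "('v, 'c) profile"
  assume f: "vccr f \<and> anonymity f \<and> neutrality f \<and> availability f \<and> upward_homogeneity f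
            \<and> monotonicity_two f \<and> neutral_reversal f \<and> coherent_IIA f \<and> coherent_defeat f
            \<and> positive_involvement_defeat f"
    and P: "is_profile P"
  interpret defeat_axioms f
    using assms(1) f by unfold_locales auto
  show "f P = sc P"
    using defeat_subset_sc[OF P] sc_subset_defeat[OF P] by blast
qed (rule vccr_sc anonymity_sc neutrality_sc availability_sc homogeneity_sc monotonicity_sc
    neutral_reversal_sc coherent_IIA_sc coherent_defeat_sc positive_involvement_defeat_sc)+

end
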